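(* For each $d \in \mathbb{N}_0$, let $\mathcal{N}_d$ denote the set of all $n \in \mathbb{N}$ for which there exists a $d$-regular circulant nut graph of order $n$. Then \[ \mathcal{N}_d = \begin{cases} \varnothing,& d = 0 \text{ or } 4 \nmid d,\\ \{ n \in \mathbb{N} \colon 2 \mid n \text{ and } n \ge d + 4 \},& d \equiv 4 \pmod 8,\\ \{14\} \cup \{ n \in \mathbb{N} \colon 2 \mid n \text{ and } n \ge 18 \},& d = 8,\\ \{ n \in \mathbb{N} \colon 2 \mid n \text{ and } n \ge d + 6 \},& 8 \mid d \text{ and } d \ge 16 . \end{cases} \]
   Context: All graphs are finite, simple, undirected and have at least one vertex; a graph of order $n$ has vertex set $\{0,1,\ldots,n-1\}$. A circulant graph is a graph whose adjacency matrix is a circulant matrix, i.e. whose $(i,j)$ entry depends only on $(j-i) \bmod n$. A nut graph is a graph with at least two vertices whose adjacency matrix has nullity exactly one and such that a (any) nonzero vector spanning its null space has no zero entries. A circulant nut graph is a nut graph that is a circulant graph. *)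

theory Defs
  imports
    "Graph_Theory.Pair_Digraph"
    "Jordan_Normal_Form.Matrix_Kernel"
begin

text \<open>
  A finite simple undirected graph is a \<^locale>\<open>pair_graph\<close>: finite vertex set, no loops, and a
  symmetric set of ordered pairs in which every edge \<open>{u, v}\<close> appears as both \<open>(u, v)\<close> and \<open>(v, u)\<close>.
\<close>

definition graph_of_order :: "nat \<Rightarrow> nat pair_pre_digraph \<Rightarrow> bool" where
  "graph_of_order n G \<longleftrightarrow> n \<ge> 1 \<and> pair_graph G \<and> pverts G = {0..<n}"

text \<open>
  As every edge is present in both directions, the out-degree of a vertex is its degree.
\<close>

definition regular_graph :: "nat \<Rightarrow> nat pair_pre_digraph \<Rightarrow> bool" where
  "regular_graph d G \<longleftrightarrow> (\<forall>v \<in> pverts G. out_degree (with_proj G) v = d)"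

text \<open>
  Rows and columns are indexed by the vertices themselves, so this is the adjacency matrix only
  when the vertex set is \<open>{0..<n}\<close>; all graphs below are restricted to \<^const>\<open>graph_of_order\<close>.
\<close>

definition adjacency_mat :: "nat pair_pre_digraph \<Rightarrow> real mat" where
  "adjacency_mat G =
    mat (card (pverts G)) (card (pverts G)) (\<lambda>(i, j). if (i, j) \<in> parcs G then 1 else 0)"

text \<open>
  The difference \<open>j - i\<close> is taken in the integers, so that \<open>(j - i) mod n\<close> is the residue
  in \<open>{0..<n}\<close> also when \<open>j < i\<close>.
\<close>

definition circulant_mat :: "'a mat \<Rightarrow> bool" where
  "circulant_mat A \<longleftrightarrow> square_mat A \<and>
    (\<exists>c :: int \<Rightarrow> 'a. \<forall>i < dim_row A. \<forall>j < dim_row A.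
      A $$ (i, j) = c ((int j - int i) mod int (dim_row A)))"

definition circulant_graph :: "nat pair_pre_digraph \<Rightarrow> bool" where
  "circulant_graph G \<longleftrightarrow> circulant_mat (adjacency_mat G)"

definition nut_graph :: "nat pair_pre_digraph \<Rightarrow> bool" where
  "nut_graph G \<longleftrightarrow> card (pverts G) \<ge> 2 \<and>
    kernel_dim (adjacency_mat G) = 1 \<and>
    (\<forall>v \<in> mat_kernel (adjacency_mat G). v \<noteq> 0\<^sub>v (card (pverts G)) \<longrightarrow>
      (\<forall>i < card (pverts G). v $ i \<noteq> 0))"

definition circulant_nut_graph :: "nat pair_pre_digraph \<Rightarrow> bool" where
  "circulant_nut_graph G \<longleftrightarrow> nut_graph G \<and> circulant_graph G"

definition circulant_nut_orders :: "nat \<Rightarrow> nat set" where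
  "circulant_nut_orders d =
    {n. \<exists>G. graph_of_order n G \<and> regular_graph d G \<and> circulant_nut_graph G}"

end

theory Submission
  imports Defs "HOL-Library.Z2"
begin

text \<open>
  Write \<open>n = 2 * h\<close> and let \<open>T \<subseteq> {1..<h}\<close> be half of the connection set of a circulant graph. Its
  eigenvalues are \<open>\<lambda>(z) = (\<Sum>s\<in>T. z\<^sup>s + z\<^sup>-\<^sup>s)\<close> for \<open>z\<^sup>n = 1\<close>, and the graph is a nut graph iff \<open>z = -1\<close> is
  the only root of unity among these with \<open>\<lambda>(z) = 0\<close>. Since \<open>\<lambda>(-1) = 0\<close>, the set \<open>T\<close> contains equally many
  even and odd elements; the orders that are too small are excluded by exhibiting a second zero.

  For existence, let \<open>T = B \<union> P \<union> (h - P)\<close> with a base \<open>B\<close> of two elements. If \<open>z\<^sup>h = -1\<close>, then the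
  contributions of \<open>P\<close> and \<open>h - P\<close> cancel, and \<open>\<lambda>(z)\<close> is a sum of two cosines. If \<open>z\<^sup>h = 1\<close>, then they are
  equal, so \<open>\<lambda>(z) \<noteq> 0\<close> as soon as the contribution of \<open>B\<close> is not divisible by \<open>2\<close> in the ring \<open>\<int>[z]\<close>.
  For a suitable \<open>B\<close>, depending on \<open>n\<close> and \<open>d\<close> modulo powers of two, this leaves only those \<open>z\<close> whose
  order is a small power of two, and parity arguments settle these.
\<close>

section \<open>Divisibility by two in rings generated by a root of unity\<close>

text \<open>The ring \<open>\<int>[z]\<close>; it contains \<open>z\<^sup>-\<^sup>1\<close> when \<open>z\<close> is a root of unity.\<close>
inductive_set cyc :: "complex \<Rightarrow> complex set" for z where
  one: "1 \<in> cyc z"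
| mult: "x \<in> cyc z \<Longrightarrow> z * x \<in> cyc z"
| diff: "x \<in> cyc z \<Longrightarrow> y \<in> cyc z \<Longrightarrow> x - y \<in> cyc z"

lemma cyc_zero: "0 \<in> cyc z"
  using cyc.diff[OF cyc.one cyc.one] by simp

lemma cyc_uminus: "x \<in> cyc z \<Longrightarrow> - x \<in> cyc z"
  using cyc.diff[OF cyc_zero] by fastforce

lemma cyc_add: "x \<in> cyc z \<Longrightarrow> y \<in> cyc z \<Longrightarrow> x + y \<in> cyc z"
  using cyc.diff[OF _ cyc_uminus] by fastforce

lemma cyc_mult: "x \<in> cyc z \<Longrightarrow> y \<in> cyc z \<Longrightarrow> x * y \<in> cyc z"
  by (induction rule: cyc.induct) (auto simp: left_diff_distrib mult.assoc intro: cyc.intros)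

lemma cyc_power: "x \<in> cyc z \<Longrightarrow> x ^ k \<in> cyc z"
  by (induction k) (auto intro: cyc.one cyc_mult)

lemma cyc_self: "z \<in> cyc z"
  using cyc.mult[OF cyc.one] by simp

lemma cyc_sum: "(\<And>i. i \<in> I \<Longrightarrow> f i \<in> cyc z) \<Longrightarrow> sum f I \<in> cyc z"
  by (induction I rule: infinite_finite_induct) (auto intro: cyc_zero cyc_add)

lemma cyc_of_nat: "of_nat k \<in> cyc z"
  by (induction k) (auto intro: cyc_zero cyc_add cyc.one)

lemma cyc_numeral: "numeral k \<in> cyc z"
  using cyc_of_nat[of "numeral k" z] by simp

lemma root_of_unity_nonzero: "z ^ n = 1 \<Longrightarrow> n > 0 \<Longrightarrow> (z :: complex) \<noteq> 0"
  by (metis zero_power zero_neq_one)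

lemma cyc_inverse: "z ^ n = 1 \<Longrightarrow> n > 0 \<Longrightarrow> inverse z \<in> cyc z"
proof -
  assume "z ^ n = 1" "n > 0"
  then have "z * z ^ (n - 1) = 1"
    by (cases n) auto
  then have "inverse z = z ^ (n - 1)"
    by (simp add: inverse_unique)
  then show ?thesis
    by (simp add: cyc_power cyc_self)
qed

lemmas cyc_intros = cyc.one cyc.diff cyc_zero cyc_uminus cyc_add cyc_mult cyc_power cyc_self
  cyc_sum cyc_of_nat cyc_numeral

text \<open>Since z^n = 1, multiplication by z rotates the coefficients cyclically, so the integer
  span of the powers below n is closed under the generating rules of the ring.\<close>

lemma cyc_span:
  assumes "z ^ n = 1" "n > 0" "x \<in> cyc z"
  shows "\<exists>c :: nat \<Rightarrow> int. x = (\<Sum>i<n. of_int (c i) * z ^ i)"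
  using assms(3)
proof induction
  case one
  have "(\<Sum>i<n. of_int (if i = 0 then 1 else 0) * z ^ i) = (\<Sum>i<n. if i = 0 then 1 else 0)"
    by (intro sum.cong) auto
  also have "\<dots> = (1 :: complex)"
    using assms by simp
  finally show ?case by (intro exI[of _ "\<lambda>i. if i = 0 then 1 else 0"]) simp
next
  case (mult x)
  then obtain c :: "nat \<Rightarrow> int" where c: "x = (\<Sum>i<n. of_int (c i) * z ^ i)" by blast
  obtain m where n: "n = Suc m" using assms by (cases n) auto
  have "z * x = (\<Sum>i<Suc m. of_int (c i) * z ^ Suc i)"
    unfolding c n sum_distrib_left by (intro sum.cong) auto
  also have "\<dots> = (\<Sum>i<m. of_int (c i) * z ^ Suc i) + of_int (c m)"
    using assms(1) by (simp add: n)
  also have "\<dots> = (\<Sum>i<n. of_int (if i = 0 then c m else c (i - 1)) * z ^ i)"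
    unfolding n sum.lessThan_Suc_shift by simp
  finally show ?case by (intro exI[of _ "\<lambda>i. if i = 0 then c m else c (i - 1)"])
next
  case (diff x y)
  then obtain c d :: "nat \<Rightarrow> int" where "x = (\<Sum>i<n. of_int (c i) * z ^ i)"
    "y = (\<Sum>i<n. of_int (d i) * z ^ i)" by blast
  then have "x - y = (\<Sum>i<n. of_int (c i - d i) * z ^ i)"
    by (simp add: sum_subtractf algebra_simps)
  then show ?case by (intro exI[of _ "\<lambda>i. c i - d i"])
qed

text \<open>If \<open>2 * x = 1\<close>, then the integer matrix of multiplication by \<open>1 - 2 * x\<close> kills the vector of
  powers of \<open>z\<close>; but it is the identity modulo 2, so its determinant is odd.\<close>
lemma cyc_two_nonunit:
  assumes "z ^ n = 1" "n > 0" "x \<in> cyc z"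
  shows "2 * x \<noteq> 1"
proof
  assume x: "2 * x = 1"
  have "\<forall>i. \<exists>c :: nat \<Rightarrow> int. x * z ^ i = (\<Sum>j<n. of_int (c j) * z ^ j)"
    using cyc_span[OF assms(1,2)] assms(3) by (meson cyc_mult cyc_power cyc_self)
  then obtain c :: "nat \<Rightarrow> nat \<Rightarrow> int" where
    c: "\<And>i. x * z ^ i = (\<Sum>j<n. of_int (c i j) * z ^ j)" by metis
  define M where "M = mat n n (\<lambda>(i, j). (if i = j then 1 else 0) - 2 * c i j)"
  have M: "M \<in> carrier_mat n n" by (simp add: M_def)
  define v where "v = vec n (\<lambda>i. z ^ i)"
  have "map_mat (of_int :: int \<Rightarrow> complex) M *\<^sub>v v = 0\<^sub>v n"
  proof (rule eq_vecI)
    fix i assume i: "i < dim_vec (0\<^sub>v n :: complex vec)"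
    then have "(map_mat of_int M *\<^sub>v v) $ i =
        (\<Sum>j<n. (if i = j then z ^ j else 0) - 2 * (of_int (c i j) * z ^ j))"
      by (auto simp: M_def v_def scalar_prod_def lessThan_atLeast0 algebra_simps intro!: sum.cong)
    also have "\<dots> = z ^ i - 2 * (x * z ^ i)"
      using i by (simp add: sum_subtractf c sum_distrib_left)
    also have "\<dots> = (1 - 2 * x) * z ^ i" by (simp add: algebra_simps)
    finally show "(map_mat of_int M *\<^sub>v v) $ i = 0\<^sub>v n $ i"
      using x i by simp
  qed (use M in auto)
  moreover have "v \<noteq> 0\<^sub>v n"
  proof
    assume "v = 0\<^sub>v n"
    then have "v $ 0 = 0\<^sub>v n $ 0" by simp
    then show False using assms(2) by (simp add: v_def)
  qed
  moreover have "v \<in> carrier_vec n" by (simp add: v_def)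
  ultimately have "det (map_mat (of_int :: int \<Rightarrow> complex) M) = 0"
    using det_0_iff_vec_prod_zero[of "map_mat of_int M" n] M by auto
  then have "det M = 0" by (simp add: of_int_hom.hom_det)
  then have "det (map_mat (of_int :: int \<Rightarrow> bit) M) = 0"
    using of_int_hom.hom_det[of M] by simp
  moreover have "map_mat (of_int :: int \<Rightarrow> bit) M = 1\<^sub>m n"
    by (rule eq_matI) (auto simp: M_def)
  ultimately show False by simp
qed

section \<open>Congruence modulo two\<close>

definition ev :: "complex \<Rightarrow> complex set" where
  "ev z = (\<lambda>x. 2 * x) ` cyc z"

lemma ev_iff: "x \<in> ev z \<longleftrightarrow> (\<exists>y \<in> cyc z. x = 2 * y)"
  by (auto simp: ev_def)

lemma evI: "y \<in> cyc z \<Longrightarrow> 2 * y \<in> ev z"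
  by (auto simp: ev_def)

lemma ev_zero: "0 \<in> ev z"
  using evI[OF cyc_zero] by simp

lemma ev_add: "x \<in> ev z \<Longrightarrow> y \<in> ev z \<Longrightarrow> x + y \<in> ev z"
  unfolding ev_iff by (metis cyc_add distrib_left)

lemma ev_diff: "x \<in> ev z \<Longrightarrow> y \<in> ev z \<Longrightarrow> x - y \<in> ev z"
  unfolding ev_iff by (metis cyc.diff right_diff_distrib)

lemma ev_mult: "x \<in> ev z \<Longrightarrow> y \<in> cyc z \<Longrightarrow> x * y \<in> ev z"
  unfolding ev_iff by (metis cyc_mult mult.assoc)

text \<open>The ideal of multiples of two is proper, so no unit of \<open>cyc z\<close> lies in it;
  exhibiting an inverse is the standard way to prove non-membership below.\<close>

lemma one_not_ev: "z ^ n = 1 \<Longrightarrow> n > 0 \<Longrightarrow> 1 \<notin> ev z"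
  using cyc_two_nonunit unfolding ev_iff by metis

text \<open>Squaring is additive modulo two, because the mixed products occur in equal
  pairs.\<close>

lemma frobenius_sum:
  assumes "finite I" "\<And>i. i \<in> I \<Longrightarrow> f i \<in> cyc z"
  shows "(sum f I)\<^sup>2 - (\<Sum>i\<in>I. (f i)\<^sup>2) \<in> ev z"
  using assms
proof (induction I)
  case (insert i I)
  have "(sum f (insert i I))\<^sup>2 - (\<Sum>i\<in>insert i I. (f i)\<^sup>2) =
      ((sum f I)\<^sup>2 - (\<Sum>i\<in>I. (f i)\<^sup>2)) + 2 * (f i * sum f I)"
    using insert by (simp add: power2_eq_square algebra_simps)
  also have "\<dots> \<in> ev z"
    using insert by (intro ev_add evI cyc_mult cyc_sum) auto
  finally show ?case .
qed (simp add: ev_zero)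

section \<open>Cosine sums modulo two\<close>

text \<open>For z on the unit circle this is twice the cosine of a times the argument of z: the
  joint contribution of a and -a to an eigenvalue.\<close>

definition cs :: "complex \<Rightarrow> nat \<Rightarrow> complex" where
  "cs z a = z ^ a + inverse z ^ a"

lemma cs_power: "cs (z ^ k) a = cs z (k * a)"
  by (simp add: cs_def power_mult power_inverse)

lemma cs_square: "z \<noteq> 0 \<Longrightarrow> (cs z a)\<^sup>2 = cs (z\<^sup>2) a + 2"
  by (simp add: cs_def power2_eq_square algebra_simps power_mult_distrib power_inverse)

text \<open>The sum-to-product formula for cosines. The factor \<open>z ^ a\<close> clears negative
  exponents, so that zeros and units can be read off the two factors.\<close>

lemma cs_add_cs:
  assumes "z \<noteq> 0" "b \<le> a"
  shows "z ^ a * (cs z a + cs z b) = (1 + z ^ (a + b)) * (1 + z ^ (a - b))"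
proof -
  have 1: "z ^ a * inverse z ^ a = 1" "z ^ a * inverse z ^ b = z ^ (a - b)"
    using assms by (simp_all add: power_inverse power_diff divide_inverse)
  have "(1 + z ^ (a + b)) * (1 + z ^ (a - b)) = 1 + z ^ (a + b) + z ^ (a - b) + z ^ a * z ^ a"
    using assms by (simp add: distrib_left distrib_right flip: power_add)
  moreover have "z ^ a * (cs z a + cs z b) =
      z ^ a * z ^ a + z ^ a * inverse z ^ a + z ^ (a + b) + z ^ a * inverse z ^ b"
    by (simp add: cs_def distrib_left power_add)
  ultimately show ?thesis using 1 by simp
qed

lemma power_eq_1_gcd:
  fixes x :: complex
  assumes "x ^ a = 1" "x ^ b = 1"
  shows "x ^ gcd a b = 1"
proof (cases "a = 0")
  case False
  then obtain s t where "a * s = b * t + gcd a b" using bezout_nat by blast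
  then have "x ^ (a * s) = x ^ (b * t) * x ^ gcd a b" by (simp add: power_add)
  then show ?thesis using assms by (simp add: power_mult)
qed (use assms in simp)

lemma coprime_power_eq_1:
  fixes x :: complex
  assumes "x ^ a = 1" "x ^ b = 1" "coprime a b"
  shows "x = 1"
  using power_eq_1_gcd[OF assms(1,2)] assms(3) by simp

text \<open>As m = 2 * k + 1 is odd, y = (y^2)^(k+1), so 1 - y is 1 - y^2 = (1 - y) * (1 + y) times
  a geometric sum. Cancelling 1 - y shows that this sum inverts 1 + y.\<close>

lemma odd_order_unit:
  assumes "y ^ m = 1" "odd m" "y \<noteq> 1" "y \<in> cyc z"
  shows "\<exists>s \<in> cyc z. (1 + y) * s = 1"
proof -
  obtain k where k: "m = 2 * k + 1" using assms(2) by (auto elim: oddE)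
  define s where "s = (\<Sum>i<Suc k. (y\<^sup>2) ^ i)"
  have "(1 - y) * ((1 + y) * s) = (1 - y\<^sup>2) * s"
    by (simp add: algebra_simps power2_eq_square)
  also have "\<dots> = 1 - (y\<^sup>2) ^ Suc k"
    unfolding s_def by (rule one_diff_power_eq[symmetric])
  also have "(y\<^sup>2) ^ Suc k = y ^ m * y"
    unfolding k power_mult[symmetric] by simp
  finally have "(1 - y) * ((1 + y) * s) = 1 - y" using assms by simp
  then have "(1 + y) * s = 1" using assms(3) by simp
  moreover have "s \<in> cyc z" unfolding s_def using assms(4) by (intro cyc_intros)
  ultimately show ?thesis by blast
qed

lemma cs_cyc: "y \<in> cyc z \<Longrightarrow> inverse y \<in> cyc z \<Longrightarrow> cs y a \<in> cyc z"
  unfolding cs_def by (intro cyc_intros)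

text \<open>The congruence is squared; mixed terms and the constants 2 from \<open>cs_square\<close>
  are absorbed by the ideal. The term w makes room for a summand that is not a cosine, such as
  \<open>z ^ k\<close>.\<close>

lemma cs_frobenius:
  assumes "y \<in> cyc z" "inverse y \<in> cyc z" "y \<noteq> 0" "finite A" "w \<in> cyc z"
    "w + (\<Sum>a\<in>A. cs y a) \<in> ev z"
  shows "w\<^sup>2 + (\<Sum>a\<in>A. cs (y\<^sup>2) a) \<in> ev z"
proof -
  let ?s = "\<Sum>a\<in>A. cs y a"
  have s: "?s \<in> cyc z" using assms by (intro cyc_intros cs_cyc)
  have 1: "?s\<^sup>2 - (\<Sum>a\<in>A. (cs y a)\<^sup>2) \<in> ev z"
    using assms by (intro frobenius_sum cs_cyc)
  have 2: "(w + ?s) * (w + ?s) \<in> ev z"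
    using assms(5,6) s by (intro ev_mult cyc_add)
  have "(\<Sum>a\<in>A. (cs y a)\<^sup>2) = (\<Sum>a\<in>A. cs (y\<^sup>2) a) + 2 * of_nat (card A)"
    using assms by (simp add: cs_square sum.distrib)
  then have "w\<^sup>2 + (\<Sum>a\<in>A. cs (y\<^sup>2) a) =
      (w + ?s) * (w + ?s) - (?s\<^sup>2 - (\<Sum>a\<in>A. (cs y a)\<^sup>2)) - 2 * (w * ?s + of_nat (card A))"
    by (simp add: power2_eq_square algebra_simps)
  also have "\<dots> \<in> ev z"
    by (intro ev_diff evI cyc_add cyc_mult 1 2 s assms(5) cyc_of_nat)
  finally show ?thesis .
qed

text \<open>For f large enough, \<open>y ^ 2 ^ f\<close> has odd order whenever y is a root of
  unity, and for odd order units are available.\<close>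

lemma cs_frobenius_power:
  assumes "y \<in> cyc z" "inverse y \<in> cyc z" "y \<noteq> 0" "finite A" "w \<in> cyc z"
    "w + (\<Sum>a\<in>A. cs y a) \<in> ev z"
  shows "w ^ 2 ^ f + (\<Sum>a\<in>A. cs (y ^ 2 ^ f) a) \<in> ev z"
proof (induction f)
  case (Suc f)
  have "inverse (y ^ 2 ^ f) \<in> cyc z"
    using assms(2) by (simp add: power_inverse[symmetric] cyc_power)
  from cs_frobenius[OF _ this _ assms(4) _ Suc]
  show ?case using assms by (simp add: cyc_power power_mult[symmetric] mult.commute)
qed (use assms in simp)

text \<open>If the sum vanished, applying \<open>f\<close> times the Frobenius map modulo 2 would make \<open>1 + 2 * card A\<close>
  divisible by 2.\<close>
lemma cs_sum_2power_nonzero: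
  assumes "z ^ 2 ^ f = 1" "finite A"
  shows "z ^ k + (\<Sum>a\<in>A. cs z a) \<noteq> 0"
proof
  assume 0: "z ^ k + (\<Sum>a\<in>A. cs z a) = 0"
  have z: "z \<noteq> 0" using root_of_unity_nonzero[OF assms(1)] by simp
  have "(z ^ k) ^ 2 ^ f + (\<Sum>a\<in>A. cs (z ^ 2 ^ f) a) \<in> ev z"
    using cs_frobenius_power[OF cyc_self cyc_inverse[OF assms(1)] z assms(2)] 0
    by (simp add: ev_zero cyc_power cyc_self)
  moreover have "(z ^ k) ^ 2 ^ f = 1"
    using assms(1) by (metis power_mult mult.commute power_one)
  ultimately have "1 + 2 * of_nat (card A) \<in> ev z"
    using assms by (simp add: cs_def mult.commute)
  from ev_diff[OF this evI[OF cyc_of_nat[of "card A"]]] show False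
    using one_not_ev[OF assms(1)] by simp
qed

text \<open>By \<open>cs_add_cs\<close> the sum is, up to the unit \<open>y ^ a\<close>, a product
  of two factors 1 + y^j. Each y^j has odd order and differs from 1, so both factors are
  invertible.\<close>

lemma double_cs_not_ev:
  assumes "z ^ n = 1" "n > 0" "y \<in> cyc z" "inverse y \<in> cyc z" "y ^ m = 1" "odd m"
    "y ^ (a + b) \<noteq> 1" "y ^ (a - b) \<noteq> 1" "b \<le> a"
  shows "cs y a + cs y b \<notin> ev z"
proof
  assume *: "cs y a + cs y b \<in> ev z"
  have y: "y \<noteq> 0" using root_of_unity_nonzero[OF assms(5)] assms(6) by (auto elim: oddE)
  have 1: "(y ^ k) ^ m = 1" for k using assms(5) by (metis power_mult mult.commute power_one)
  obtain s t where st: "s \<in> cyc z" "t \<in> cyc z" "(1 + y ^ (a + b)) * s = 1" "(1 + y ^ (a - b)) * t = 1"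
    using odd_order_unit[OF 1 assms(6) assms(7) cyc_power[OF assms(3)]]
      odd_order_unit[OF 1 assms(6) assms(8) cyc_power[OF assms(3)]] by blast
  have "(cs y a + cs y b) * (y ^ a * s * t) = (y ^ a * (cs y a + cs y b)) * s * t"
    by (simp only: mult_ac)
  also have "\<dots> = ((1 + y ^ (a + b)) * s) * ((1 + y ^ (a - b)) * t)"
    unfolding cs_add_cs[OF y assms(9)] by (simp only: mult_ac)
  also have "\<dots> = 1" using st by simp
  finally have "1 \<in> ev z" using ev_mult[OF *, of "y ^ a * s * t"] st assms(3)
    by (auto intro!: cyc_mult cyc_power)
  then show False using one_not_ev assms by blast
qed

text \<open>Doubling the angle: if \<open>cos \<phi> = x\<close> lies in the ring, so does \<open>cos (2 * \<phi>) = 2 * x\<^sup>2 - 1\<close>;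
  iterating reaches \<open>cos \<phi> = 0\<close> and then \<open>2 * x\<^sup>2 = 1\<close>.\<close>
lemma cs_2power_not_ev:
  assumes "z ^ n = 1" "n > 0" "u ^ 2 ^ f = 1" "u ^ 4 \<noteq> 1"
  shows "u + inverse u \<notin> ev z"
  using assms(3,4)
proof (induction f arbitrary: u)
  case (Suc f)
  have u: "u \<noteq> 0" using root_of_unity_nonzero[OF Suc.prems(1)] by simp
  show ?case
  proof
    assume "u + inverse u \<in> ev z"
    then obtain x where x: "x \<in> cyc z" "u + inverse u = 2 * x" by (auto simp: ev_iff)
    have "u\<^sup>2 + inverse (u\<^sup>2) = (u + inverse u)\<^sup>2 - 2"
      using u by (simp add: power2_eq_square algebra_simps)
    also have "\<dots> = 2 * (2 * x\<^sup>2 - 1)"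
      by (simp add: x power2_eq_square)
    finally have eq: "u\<^sup>2 + inverse (u\<^sup>2) = 2 * (2 * x\<^sup>2 - 1)" .
    show False
    proof (cases "(u\<^sup>2) ^ 4 = 1")
      case True
      moreover have "(u\<^sup>2) ^ 4 - 1 = (u ^ 4 - 1) * (u ^ 4 + 1)"
        by (simp add: eval_nat_numeral algebra_simps)
      ultimately have "(u ^ 4 - 1) * (u ^ 4 + 1) = 0" by simp
      then have "u ^ 4 + 1 = 0" using Suc.prems by simp
      moreover have "u\<^sup>2 * (u\<^sup>2 + inverse (u\<^sup>2)) = u ^ 4 + 1"
        using u by (simp add: distrib_left flip: power_add)
      ultimately have "u\<^sup>2 * (u\<^sup>2 + inverse (u\<^sup>2)) = 0" by simp
      then have "2 * x\<^sup>2 = 1" using eq u by simp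
      then show False using cyc_two_nonunit[OF assms(1,2) cyc_power[OF x(1)]] by blast
    next
      case False
      have "2 * x\<^sup>2 - 1 \<in> cyc z" using x(1) by (intro cyc_intros)
      then have "u\<^sup>2 + inverse (u\<^sup>2) \<in> ev z" unfolding eq by (rule evI)
      with Suc.IH[of "u\<^sup>2"] False Suc.prems show False
        by (simp add: power_mult[symmetric])
    qed
  qed
qed auto

text \<open>Put u = z^a and let 2^f be the 2-part of n. If u^(2^f) = 1, the case of 2-power order
  applies. Otherwise Frobenius passes to y = u^(2^f), which has odd order and is not 1, and y * (y +
  1/y) = 1 + y^2 is a unit.\<close>

lemma cs_not_ev:
  assumes "z ^ n = 1" "n > 0" "z ^ (4 * a) \<noteq> 1"
  shows "cs z a \<notin> ev z"
proof
  assume ev: "cs z a \<in> ev z"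
  have z: "z \<noteq> 0" using root_of_unity_nonzero[OF assms(1,2)] .
  note inv = cyc_inverse[OF assms(1,2)]
  define f where "f = multiplicity 2 n"
  obtain m where m: "n = 2 ^ f * m" "odd m"
    unfolding f_def using multiplicity_decompose'[of n 2] assms(2) by auto
  define u where "u = z ^ a"
  have cs: "cs z a = u + inverse u" by (simp add: cs_def u_def power_inverse)
  have u4: "u ^ 4 \<noteq> 1" using assms(3) by (simp add: u_def mult.commute flip: power_mult)
  define y where "y = u ^ 2 ^ f"
  have "y ^ m = (z ^ n) ^ a" by (simp add: y_def u_def m mult_ac flip: power_mult)
  then have ym: "y ^ m = 1" using assms by simp
  show False
  proof (cases "y = 1")
    case True
    then show False using cs_2power_not_ev[OF assms(1,2) _ u4] ev cs by (simp add: y_def)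
  next
    case False
    have y2: "y\<^sup>2 \<noteq> 1" using coprime_power_eq_1[of y 2 m] ym False m(2) by auto
    have yc: "y \<in> cyc z" by (simp add: y_def u_def cyc_power cyc_self)
    have "cs (z ^ 2 ^ f) a \<in> ev z"
      using cs_frobenius_power[OF cyc_self inv z, of "{a}" 0 f] ev by (simp add: cyc_zero zero_power)
    moreover have "cs (z ^ 2 ^ f) a = y + inverse y"
      by (simp add: cs_def y_def u_def power_inverse flip: power_mult) (simp add: mult.commute)
    ultimately have 1: "y + inverse y \<in> ev z" by simp
    have "(y\<^sup>2) ^ m = 1" using ym by (metis power_mult mult.commute power_one)
    from odd_order_unit[OF this m(2) y2 cyc_power[OF yc]]
    obtain s where s: "s \<in> cyc z" "(1 + y\<^sup>2) * s = 1" by blast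
    have "y \<noteq> 0" using z by (simp add: y_def u_def)
    then have "(y + inverse y) * (y * s) = (1 + y\<^sup>2) * s"
      by (simp add: power2_eq_square algebra_simps)
    then have "1 \<in> ev z" using ev_mult[OF 1 cyc_mult[OF yc s(1)]] s by simp
    then show False using one_not_ev assms by blast
  qed
qed

section \<open>Circulant graphs and their kernels\<close>

text \<open>The singleton \<open>{v}\<close> is a basis of the kernel: it spans by assumption, and a
  nonzero coordinate of v makes it independent.\<close>

lemma kernel_dim_eq_1I:
  fixes A :: "'a :: field mat"
  assumes v: "v \<in> mat_kernel A" "v \<noteq> 0\<^sub>v (dim_col A)"
    and all: "\<And>w. w \<in> mat_kernel A \<Longrightarrow> \<exists>c. w = c \<cdot>\<^sub>v v"
  shows "kernel_dim A = 1"
proof -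
  interpret kernel "dim_row A" "dim_col A" A by unfold_locales auto
  have sub: "{v} \<subseteq> mat_kernel A" using v by simp
  have vc: "v \<in> carrier_vec (dim_col A)" using v by (auto simp: mat_kernel_def)
  obtain i where i: "i < dim_col A" "v $ i \<noteq> 0"
    using v(2) vc by (metis carrier_vecD eq_vecI index_zero_vec)
  have lin: "lincomb a {v} = a v \<cdot>\<^sub>v v" for a
  proof (rule eq_vecI)
    have "lincomb a {v} \<in> mat_kernel A"
      by (rule Ker.lincomb_closed) (use sub in auto)
    then show "dim_vec (lincomb a {v}) = dim_vec (a v \<cdot>\<^sub>v v)"
      using vc by (auto simp: mat_kernel_def)
  qed (use lincomb_index[OF _ sub] vc in auto)
  have "Ker.basis {v}"
    unfolding Ker.basis_def
  proof (intro conjI)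
    show "span {v} = mat_kernel A"
    proof
      show "mat_kernel A \<subseteq> span {v}"
      proof
        fix w assume "w \<in> mat_kernel A"
        then obtain c where "w = c \<cdot>\<^sub>v v" using all by blast
        then have "w = lincomb (\<lambda>_. c) {v}" by (simp add: lin)
        then show "w \<in> span {v}" unfolding Ker.span_def by force
      qed
    qed (rule Ker.span_is_subset2[OF sub])
    show "lin_indpt {v}"
    proof (rule Ker.finite_lin_indpt2)
      fix a assume "lincomb a {v} = 0\<^sub>v (dim_col A)"
      then have "(a v \<cdot>\<^sub>v v) $ i = 0" using i by (simp add: lin)
      then have "a v = 0" using i vc by simp
      then show "\<forall>x\<in>{v}. a x = 0" by simp
    qed (use sub in auto)
  qed (rule sub)
  from Ker.dim_basis[OF _ this] show ?thesis by simp
qed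

text \<open>If zero were the only kernel vector, the empty set would be a basis and the dimension
  would be 0.\<close>

lemma kernel_dim_eq_1D:
  fixes A :: "'a :: field mat"
  assumes "kernel_dim A = 1"
  shows "\<exists>v \<in> mat_kernel A. v \<noteq> 0\<^sub>v (dim_col A)"
proof (rule ccontr)
  assume "\<not> ?thesis"
  interpret kernel "dim_row A" "dim_col A" A by unfold_locales auto
  have "0\<^sub>v (dim_col A) \<in> mat_kernel A" by (auto simp: mat_kernel_def)
  with \<open>\<not> ?thesis\<close> have 0: "mat_kernel A = {0\<^sub>v (dim_col A)}" by auto
  have "Ker.basis {}"
    unfolding Ker.basis_def
  proof (intro conjI)
    show "lin_indpt {}" by (rule Ker.finite_lin_indpt2) auto
    show "span {} = mat_kernel A" using Ker.span_empty 0 by simp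
  qed auto
  from Ker.dim_basis[OF _ this] assms show False by simp
qed

section \<open>Circulant graphs and their connection sets\<close>

text \<open>The sum \<open>j + (n - i)\<close> stands for \<open>j - i\<close>, which would be truncated on the natural numbers.\<close>
definition circ :: "nat \<Rightarrow> nat set \<Rightarrow> nat pair_pre_digraph" where
  "circ n S = \<lparr>pverts = {0..<n}, parcs = {(i, j). i < n \<and> j < n \<and> (j + (n - i)) mod n \<in> S}\<rparr>"

lemma mod_sub_nat:
  "i < n \<Longrightarrow> j < n \<Longrightarrow> (j + (n - i)) mod n = (if i \<le> j then j - i else j + n - i)" for i j n :: nat
  by (auto simp: mod_if)

text \<open>Translation by i carries the connection set to the out-neighbours of i. With S the set
  of all residues, it also reindexes full cyclic sums.\<close>

lemma bij_betw_shift: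
  fixes S :: "nat set"
  assumes "S \<subseteq> {0..<n}" "i < n"
  shows "bij_betw (\<lambda>s. (i + s) mod n) S {j. j < n \<and> (j + (n - i)) mod n \<in> S}"
proof -
  have 1: "((i + s) mod n + (n - i)) mod n = s" if "s \<in> S" for s
  proof -
    have "((i + s) mod n + (n - i)) mod n = (i + s + (n - i)) mod n" by (rule mod_add_left_eq)
    also have "i + s + (n - i) = s + n" using assms by simp
    finally show ?thesis using that assms by auto
  qed
  have 2: "(i + (j + (n - i)) mod n) mod n = j" if "j < n" for j
  proof -
    have "(i + (j + (n - i)) mod n) mod n = (i + (j + (n - i))) mod n" by (rule mod_add_right_eq)
    also have "i + (j + (n - i)) = j + n" using assms by simp
    finally show ?thesis using that by simp
  qed
  show ?thesis
    by (rule bij_betw_byWitness[where f' = "\<lambda>j. (j + (n - i)) mod n"]) (use 1 2 assms in auto)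
qed

lemma circ_regular:
  assumes "S \<subseteq> {0..<n}" "n \<ge> 1"
  shows "regular_graph d (circ n S) \<longleftrightarrow> card S = d"
proof -
  have "out_degree (with_proj (circ n S)) v = card S" if "v < n" for v
  proof -
    have "out_arcs (with_proj (circ n S)) v = Pair v ` {j. j < n \<and> (j + (n - v)) mod n \<in> S}"
      using that by (auto simp: out_arcs_def circ_def)
    then show ?thesis
      using bij_betw_same_card[OF bij_betw_shift[OF assms(1) that]]
      by (simp add: out_degree_def card_image inj_on_def)
  qed
  then show ?thesis using assms(2) by (force simp: regular_graph_def circ_def)
qed

lemma circ_graph_of_order:
  assumes "S \<subseteq> {1..<n}" "\<And>s. s \<in> S \<Longrightarrow> n - s \<in> S" "n \<ge> 1"
  shows "graph_of_order n (circ n S)"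
proof -
  have "pair_graph (circ n S)"
  proof
    fix e assume e: "e \<in> parcs (circ n S)"
    then show "fst e \<in> pverts (circ n S)" "snd e \<in> pverts (circ n S)"
      by (auto simp: circ_def)
    show "fst e \<noteq> snd e" using e assms(1) by (auto simp: circ_def)
  next
    show "finite (pverts (circ n S))" by (simp add: circ_def)
    show "finite (parcs (circ n S))"
      by (rule finite_subset[of _ "{0..<n} \<times> {0..<n}"]) (auto simp: circ_def)
    have "(j, i) \<in> parcs (circ n S)" if "(i, j) \<in> parcs (circ n S)" for i j
    proof -
      have ij: "i < n" "j < n" "(j + (n - i)) mod n \<in> S" using that by (auto simp: circ_def)
      then have "i \<noteq> j" using assms(1) by auto
      \<comment> \<open>The residues of j - i and i - j are nonzero and therefore add up to
        n.\<close>
      then have "(i + (n - j)) mod n = n - (j + (n - i)) mod n"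
        unfolding mod_sub_nat[OF ij(1,2)] mod_sub_nat[OF ij(2,1)] using ij(1,2) by auto
      then show ?thesis using ij assms(2)[OF ij(3)] by (simp add: circ_def)
    qed
    then show "symmetric (with_proj (circ n S))"
      unfolding symmetric_def by (simp add: sym_def)
  qed
  then show ?thesis using assms(3) by (simp add: graph_of_order_def circ_def)
qed

lemma int_mod_sub:
  assumes "i < n" "j < n"
  shows "(int j - int i) mod int n = int ((j + (n - i)) mod n)"
proof -
  have "int ((j + (n - i)) mod n) = (int j - int i + int n) mod int n"
    using assms by (simp add: zmod_int of_nat_diff algebra_simps)
  then show ?thesis by simp
qed

lemma adjacency_circ:
  "adjacency_mat (circ n S) =
    mat n n (\<lambda>(i, j). if (j + (n - i)) mod n \<in> S then 1 else 0)"
  by (rule eq_matI) (auto simp: adjacency_mat_def circ_def)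

lemma circ_circulant: "circulant_graph (circ n S)"
  unfolding circulant_graph_def circulant_mat_def
proof (intro conjI exI allI impI)
  fix i j assume "i < dim_row (adjacency_mat (circ n S))" "j < dim_row (adjacency_mat (circ n S))"
  then show "adjacency_mat (circ n S) $$ (i, j) =
      (\<lambda>k. if nat k \<in> S then 1 else 0) ((int j - int i) mod int (dim_row (adjacency_mat (circ n S))))"
    by (simp add: adjacency_circ int_mod_sub)
qed (simp add: adjacency_circ)

text \<open>S is the neighbourhood of vertex 0, and the circulant property transports every entry to
  row 0. Absence of loops keeps 0 out of S, and symmetry of the arcs gives closure under
  negation.\<close>

lemma circulant_graph_circ:
  assumes "graph_of_order n G" "circulant_graph G"
  obtains S where "S \<subseteq> {1..<n}" "\<And>s. s \<in> S \<Longrightarrow> n - s \<in> S" "G = circ n S"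
proof
  interpret pair_graph G using assms by (simp add: graph_of_order_def)
  have n: "n \<ge> 1" and V: "pverts G = {0..<n}" using assms by (auto simp: graph_of_order_def)
  define S where "S = {s. (0, s) \<in> parcs G}"
  obtain c where c: "\<And>i j. i < n \<Longrightarrow> j < n \<Longrightarrow>
      adjacency_mat G $$ (i, j) = c ((int j - int i) mod int n)"
    using assms(2) by (auto simp: circulant_graph_def circulant_mat_def adjacency_mat_def V)
  have arc: "(i, j) \<in> parcs G \<longleftrightarrow> (j + (n - i)) mod n \<in> S" if "i < n" "j < n" for i j
  proof -
    have "adjacency_mat G $$ (i, j) = adjacency_mat G $$ (0, (j + (n - i)) mod n)"
      using that n by (simp add: c int_mod_sub)
    then show ?thesis using that n
      by (auto simp: adjacency_mat_def V S_def split: if_splits)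
  qed
  show "S \<subseteq> {1..<n}"
  proof
    fix s assume "s \<in> S"
    then have "(0, s) \<in> parcs G" by (simp add: S_def)
    then have "s < n" "s \<noteq> 0" using in_arcsD2[of 0 s] pair_no_loops[of "(0, s)"] V by auto
    then show "s \<in> {1..<n}" by auto
  qed
  show "n - s \<in> S" if "s \<in> S" for s
  proof -
    have s: "(0, s) \<in> parcs G" "0 < s" "s < n"
      using that \<open>S \<subseteq> {1..<n}\<close> by (auto simp: S_def)
    then have "(s, 0) \<in> parcs G" using pair_sym_arcs by (auto simp: symmetric_def dest: symD)
    then show ?thesis using arc[of s 0] s by simp
  qed
  show "G = circ n S"
  proof (rule pair_pre_digraph.equality)
    have "(i, j) \<in> parcs G \<longleftrightarrow> (i, j) \<in> parcs (circ n S)" for i j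
    proof (cases "i < n \<and> j < n")
      case False
      then show ?thesis using in_arcsD1[of i j] in_arcsD2[of i j] V by (auto simp: circ_def)
    qed (simp add: circ_def arc)
    then show "parcs G = parcs (circ n S)" by (auto simp only: set_eq_iff split_paired_All)
  qed (auto simp: circ_def V)
qed

section \<open>Kernel equations and the discrete Fourier transform\<close>

lemma mat_kernel_circ:
  assumes "S \<subseteq> {0..<n}"
  shows "x \<in> mat_kernel (adjacency_mat (circ n S)) \<longleftrightarrow>
    dim_vec x = n \<and> (\<forall>i<n. (\<Sum>s\<in>S. x $ ((i + s) mod n)) = 0)"
proof -
  have "(adjacency_mat (circ n S) *\<^sub>v x) $ i = (\<Sum>s\<in>S. x $ ((i + s) mod n))"
    if "i < n" "dim_vec x = n" for i
  proof -
    have "(adjacency_mat (circ n S) *\<^sub>v x) $ i =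
        (\<Sum>j\<in>{0..<n}. if (j + (n - i)) mod n \<in> S then x $ j else 0)"
      using that by (auto simp: adjacency_circ scalar_prod_def intro!: sum.cong)
    also have "\<dots> = (\<Sum>j\<in>{j. j < n \<and> (j + (n - i)) mod n \<in> S}. x $ j)"
      by (intro sum.mono_neutral_cong_right) auto
    also have "\<dots> = (\<Sum>s\<in>S. x $ ((i + s) mod n))"
      by (rule sum.reindex_bij_betw[OF bij_betw_shift[OF assms that(1)], symmetric])
    finally show ?thesis .
  qed
  note entry = this
  have dims: "dim_row (adjacency_mat (circ n S)) = n" "dim_col (adjacency_mat (circ n S)) = n"
    by (simp_all add: adjacency_circ)
  have "adjacency_mat (circ n S) *\<^sub>v x = 0\<^sub>v n \<longleftrightarrow> (\<forall>i<n. (\<Sum>s\<in>S. x $ ((i + s) mod n)) = 0)"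
    if x: "dim_vec x = n"
  proof
    assume "adjacency_mat (circ n S) *\<^sub>v x = 0\<^sub>v n"
    then show "\<forall>i<n. (\<Sum>s\<in>S. x $ ((i + s) mod n)) = 0"
      using entry[OF _ x] by (metis index_zero_vec(1))
  next
    assume "\<forall>i<n. (\<Sum>s\<in>S. x $ ((i + s) mod n)) = 0"
    then show "adjacency_mat (circ n S) *\<^sub>v x = 0\<^sub>v n"
      by (intro eq_vecI) (simp_all add: entry x dims del: index_mult_mat_vec)
  qed
  then show ?thesis
    unfolding mat_kernel_def dims by (auto simp only: carrier_vec_def mem_Collect_eq)
qed

lemma power_mod_root:
  fixes z :: "'a :: monoid_mult"
  assumes "z ^ n = 1"
  shows "z ^ (k mod n) = z ^ k"
proof -
  have "z ^ k = z ^ (n * (k div n) + k mod n)" by simp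
  also have "\<dots> = z ^ (k mod n)" by (simp only: power_add power_mult assms power_one mult_1_left)
  finally show ?thesis by simp
qed

text \<open>The shift rule of the discrete Fourier transform at an n-th root of unity, with the
  phase factor moved to the left to avoid an inverse.\<close>

lemma sum_shift:
  fixes z :: complex
  assumes "z ^ n = 1" "s < n"
  shows "z ^ s * (\<Sum>i<n. z ^ i * f ((i + s) mod n)) = (\<Sum>i<n. z ^ i * f i)"
proof -
  have set: "{j. j < n \<and> (j + (n - s)) mod n \<in> {0..<n}} = {..<n}"
    using assms(2) by auto
  have "z ^ s * (\<Sum>i<n. z ^ i * f ((i + s) mod n)) =
      (\<Sum>i\<in>{0..<n}. z ^ ((s + i) mod n) * f ((s + i) mod n))"
    unfolding lessThan_atLeast0 sum_distrib_left power_mod_root[OF assms(1)] power_add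
    by (intro sum.cong) (simp_all add: add.commute)
  also have "\<dots> = (\<Sum>i<n. z ^ i * f i)"
    using sum.reindex_bij_betw[OF bij_betw_shift[of "{0..<n}" n s], of "\<lambda>j. z ^ j * f j"] assms(2)
    unfolding set by simp
  finally show ?thesis .
qed

lemma sum_reflect:
  fixes n :: nat
  assumes "S \<subseteq> {1..<n}" "\<And>s. s \<in> S \<Longrightarrow> n - s \<in> S"
  shows "(\<Sum>s\<in>S. f (n - s)) = (\<Sum>s\<in>S. f s)"
proof (rule sum.reindex_bij_witness[where i = "\<lambda>s. n - s" and j = "\<lambda>s. n - s"])
  fix s assume "s \<in> S"
  then show "n - (n - s) = s" "n - (n - s) = s" using assms(1) by auto
qed (use assms in auto)

text \<open>By \<open>alt\<close> the alternating vector lies in the kernel. Conversely, the Fourier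
  transform of a kernel vector w, times the eigenvalue, is zero at every n-th root of unity, so the
  transform vanishes except perhaps at -1. Then the transform of w plus its shift vanishes
  everywhere, which forces w to alternate.\<close>

lemma circulant_nut_ordersI:
  fixes n :: nat
  assumes S: "S \<subseteq> {1..<n}" "\<And>s. s \<in> S \<Longrightarrow> n - s \<in> S" and n: "even n" and ne: "S \<noteq> {}"
    and alt: "(\<Sum>s\<in>S. (-1) ^ s :: int) = 0"
    and nz: "\<And>z :: complex. z ^ n = 1 \<Longrightarrow> z \<noteq> 1 \<Longrightarrow> z \<noteq> -1 \<Longrightarrow> (\<Sum>s\<in>S. z ^ s) \<noteq> 0"
  shows "n \<in> circulant_nut_orders (card S)"
proof -
  have fin: "finite S" using S(1) by (rule finite_subset) auto
  have n2: "n \<ge> 2" using S(1) ne by force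
  have S0: "S \<subseteq> {0..<n}" using S(1) by auto
  let ?A = "adjacency_mat (circ n S)"
  have cA: "dim_col ?A = n" by (simp add: adjacency_circ)
  define v :: "real vec" where "v = vec n (\<lambda>i. (-1) ^ i)"
  have "(-1 :: real) ^ n = 1" using n by simp
  note alt_mod = power_mod_root[OF this]
  have vk: "v \<in> mat_kernel ?A"
    unfolding mat_kernel_circ[OF S0]
  proof (intro conjI allI impI)
    fix i assume "i < n"
    have "(\<Sum>s\<in>S. v $ ((i + s) mod n)) = (\<Sum>s\<in>S. (-1) ^ i * of_int ((-1) ^ s))"
      using n2 by (intro sum.cong) (simp_all add: v_def alt_mod power_add)
    also have "\<dots> = (-1) ^ i * of_int (\<Sum>s\<in>S. (-1) ^ s)"
      by (simp only: sum_distrib_left of_int_sum)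
    finally show "(\<Sum>s\<in>S. v $ ((i + s) mod n)) = 0" by (simp add: alt)
  qed (simp add: v_def)
  have span: "\<exists>c. w = c \<cdot>\<^sub>v v" if "w \<in> mat_kernel ?A" for w
  proof -
    have dw: "dim_vec w = n" and w: "\<And>i. i < n \<Longrightarrow> (\<Sum>s\<in>S. w $ ((i + s) mod n)) = 0"
      using that mat_kernel_circ[OF S0] by auto
    define X where "X z = (\<Sum>i<n. z ^ i * complex_of_real (w $ i))" for z
    have shift: "(\<Sum>i<n. z ^ i * complex_of_real (w $ ((i + s) mod n))) = z ^ (n - s) * X z"
      if "z ^ n = 1" "s < n" for z s
    proof -
      have "z ^ (n - s) * z ^ s = 1" using that by (simp flip: power_add)
      then have "(\<Sum>i<n. z ^ i * complex_of_real (w $ ((i + s) mod n))) =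
          z ^ (n - s) * (z ^ s * (\<Sum>i<n. z ^ i * complex_of_real (w $ ((i + s) mod n))))"
        by (simp only: mult.assoc[symmetric] mult_1_left)
      then show ?thesis
        unfolding X_def sum_shift[OF that, of "\<lambda>i. complex_of_real (w $ i)"] .
    qed
    have FX: "(\<Sum>s\<in>S. z ^ s) * X z = 0" if z: "z ^ n = 1" for z
    proof -
      have "0 = (\<Sum>i<n. z ^ i * complex_of_real (\<Sum>s\<in>S. w $ ((i + s) mod n)))"
        by (simp add: w)
      also have "\<dots> = (\<Sum>s\<in>S. \<Sum>i<n. z ^ i * complex_of_real (w $ ((i + s) mod n)))"
        unfolding of_real_sum sum_distrib_left by (rule sum.swap)
      also have "\<dots> = (\<Sum>s\<in>S. z ^ (n - s) * X z)"
        using S(1) by (intro sum.cong shift[OF z]) auto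
      \<comment> \<open>S is closed under negation, so the conjugate eigenvalue equals the
        eigenvalue.\<close>
      also have "\<dots> = (\<Sum>s\<in>S. z ^ s) * X z"
        unfolding sum_distrib_right by (rule sum_reflect[OF S])
      finally show ?thesis by simp
    qed
    have X0: "X z = 0" if "z ^ n = 1" "z \<noteq> -1" for z
    proof -
      \<comment> \<open>At z = 1 the sum is the positive cardinality of S; the other roots are
        covered by \<open>nz\<close>.\<close>
      have "(\<Sum>s\<in>S. z ^ s) \<noteq> 0"
        using nz[OF that(1)] that(2) fin ne by (cases "z = 1") auto
      then show ?thesis using FX[OF that(1)] by simp
    qed
    \<comment> \<open>The transform of y is (1 + z^(n-1)) * X(z). As n is even, the first factor
      vanishes at z = -1, the only root where X may be nonzero; so p has n roots but degree below
      n.\<close>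
    define y where "y i = complex_of_real (w $ i + w $ ((i + 1) mod n))" for i
    define p where "p = (\<Sum>i<n. monom (y i) i)"
    have "p = 0"
    proof (rule poly_eqI_degree)
      fix z :: complex assume "z \<in> {z. z ^ n = 1}"
      then have z: "z ^ n = 1" by simp
      have "poly p z = X z + (\<Sum>i<n. z ^ i * complex_of_real (w $ ((i + 1) mod n)))"
        by (simp add: p_def poly_sum poly_monom y_def X_def sum.distrib algebra_simps)
      also have "\<dots> = (1 + z ^ (n - 1)) * X z"
        using shift[OF z, of 1] n2 by (simp add: algebra_simps)
      also have "\<dots> = 0"
        using X0[OF z] n n2 by (cases "z = -1") auto
      finally show "poly p z = poly 0 z" by simp
    next
      have "degree p < n"
        unfolding p_def using n2 by (intro degree_sum_less) (auto intro: le_less_trans[OF degree_monom_le])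
      then show "degree p < card {z :: complex. z ^ n = 1}" "degree (0 :: complex poly) < card {z :: complex. z ^ n = 1}"
        using n2 by (simp_all add: card_roots_unity_eq)
    qed
    moreover have "coeff p i = y i" if "i < n" for i
      using that by (simp add: p_def coeff_sum)
    ultimately have "y i = 0" if "i < n" for i
      using that by simp
    then have step: "w $ ((i + 1) mod n) = - (w $ i)" if "i < n" for i
      using that unfolding y_def of_real_eq_0_iff by (simp add: add_eq_0_iff)
    have alt: "w $ i = w $ 0 * (-1) ^ i" if "i < n" for i
      using that
    proof (induction i)
      case (Suc i)
      then show ?case using step[of i] by simp
    qed simp
    have "w = (w $ 0) \<cdot>\<^sub>v v"
    proof (rule eq_vecI)
      fix i assume "i < dim_vec ((w $ 0) \<cdot>\<^sub>v v)"
      then show "w $ i = ((w $ 0) \<cdot>\<^sub>v v) $ i" using alt[of i] by (simp add: v_def)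
    qed (simp add: dw v_def)
    then show ?thesis by blast
  qed
  have v0: "v \<noteq> 0\<^sub>v n"
  proof
    assume "v = 0\<^sub>v n"
    then have "v $ 0 = 0\<^sub>v n $ 0" by simp
    then show False using n2 by (simp add: v_def)
  qed
  have "nut_graph (circ n S)"
    unfolding nut_graph_def
  proof (intro conjI ballI impI allI)
    show "2 \<le> card (pverts (circ n S))" using n2 by (simp add: circ_def)
    show "kernel_dim ?A = 1" using vk v0 span by (intro kernel_dim_eq_1I) (simp_all add: cA)
    fix w i assume w: "w \<in> mat_kernel ?A" "w \<noteq> 0\<^sub>v (card (pverts (circ n S)))"
      and i: "i < card (pverts (circ n S))"
    obtain c where c: "w = c \<cdot>\<^sub>v v" using span[OF w(1)] by blast
    then have "c \<noteq> 0" using w(2) by (auto simp: v_def circ_def)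
    then show "w $ i \<noteq> 0" using i by (simp add: c v_def circ_def)
  qed
  then have "circulant_nut_graph (circ n S)" by (simp add: circulant_nut_graph_def circ_circulant)
  moreover have "graph_of_order n (circ n S)" using circ_graph_of_order[OF S] n2 by simp
  moreover have "regular_graph (card S) (circ n S)" using circ_regular[OF S0] n2 by simp
  ultimately show ?thesis unfolding circulant_nut_orders_def by blast
qed

text \<open>The kernel is a line invariant under the cyclic shift, so v is a geometric sequence with
  real ratio c. From c^n = 1 and c \<noteq> 1 follow c = -1 and the evenness of n. A root z with
  zero eigenvalue yields another kernel vector, which must be proportional to v.\<close>

lemma circulant_nut_ordersD:
  assumes "n \<in> circulant_nut_orders d"
  obtains S where "S \<subseteq> {1..<n}" "\<And>s. s \<in> S \<Longrightarrow> n - s \<in> S" "card S = d" "d > 0" "even n"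
    "(\<Sum>s\<in>S. (-1) ^ s :: int) = 0"
    "\<And>z :: complex. z ^ n = 1 \<Longrightarrow> (\<Sum>s\<in>S. z ^ s) = 0 \<Longrightarrow> z = -1"
proof -
  obtain G where G: "graph_of_order n G" "regular_graph d G" "nut_graph G" "circulant_graph G"
    using assms by (auto simp: circulant_nut_orders_def circulant_nut_graph_def)
  obtain S where S: "S \<subseteq> {1..<n}" "\<And>s. s \<in> S \<Longrightarrow> n - s \<in> S" and circ: "G = circ n S"
    using circulant_graph_circ[OF G(1,4)] by blast
  have fin: "finite S" using S(1) by (rule finite_subset) auto
  have S0: "S \<subseteq> {0..<n}" using S(1) by auto
  have card_v: "card (pverts G) = n" by (simp add: circ circ_def)
  then have n2: "n \<ge> 2" using G(3) by (simp add: nut_graph_def)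
  have cardS: "card S = d" using G(2) circ_regular[OF S0] n2 by (simp add: circ)
  let ?A = "adjacency_mat G"
  have cA: "dim_col ?A = n" by (simp add: adjacency_circ circ)
  note kern = mat_kernel_circ[OF S0, folded circ]
  have full: "w $ i \<noteq> 0" if "w \<in> mat_kernel ?A" "w \<noteq> 0\<^sub>v n" "i < n" for w i
    using G(3) that by (simp add: nut_graph_def card_v)
  obtain v where v: "v \<in> mat_kernel ?A" "v \<noteq> 0\<^sub>v n"
    using kernel_dim_eq_1D[of ?A] G(3) by (auto simp: nut_graph_def cA)
  have v0: "v $ 0 \<noteq> 0" using full[OF v] n2 by simp
  have proportional: "v $ 0 * u $ i = u $ 0 * v $ i" if u: "u \<in> mat_kernel ?A" and i: "i < n" for u i
  proof -
    \<comment> \<open>This combination vanishes at coordinate 0, whereas a nonzero kernel vector of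
      a nut graph has no zero entry.\<close>
    define w where "w = vec n (\<lambda>i. v $ 0 * u $ i - u $ 0 * v $ i)"
    have "w \<in> mat_kernel ?A"
      unfolding kern
    proof (intro conjI allI impI)
      fix i assume i: "i < n"
      have "(\<Sum>s\<in>S. w $ ((i + s) mod n)) =
          v $ 0 * (\<Sum>s\<in>S. u $ ((i + s) mod n)) - u $ 0 * (\<Sum>s\<in>S. v $ ((i + s) mod n))"
        using n2 by (simp add: w_def sum_subtractf sum_distrib_left)
      then show "(\<Sum>s\<in>S. w $ ((i + s) mod n)) = 0"
        using u v(1) i unfolding kern by simp
    qed (simp add: w_def)
    moreover have "w $ 0 = 0" using n2 by (simp add: w_def)
    ultimately have "w = 0\<^sub>v n" using full[of w 0] n2 by auto
    then have "w $ i = 0\<^sub>v n $ i" by simp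
    then show ?thesis using i by (simp add: w_def)
  qed
  have d: "d > 0"
  proof (rule ccontr)
    assume "\<not> d > 0"
    \<comment> \<open>Without edges the adjacency matrix is zero, and its kernel contains vectors
      with zero entries.\<close>
    then have "S = {}" using cardS fin by simp
    then have "unit_vec n 0 \<in> mat_kernel ?A" unfolding kern by simp
    moreover have "unit_vec n 0 \<noteq> (0\<^sub>v n :: real vec)"
      using n2 by (metis index_unit_vec(2) index_zero_vec(1) less_le_trans pos2 zero_neq_one)
    ultimately show False using full[of "unit_vec n 0" 1] n2 by simp
  qed
  define c where "c = v $ 1 / v $ 0"
  have step: "v $ ((i + 1) mod n) = c * v $ i" if i: "i < n" for i
  proof -
    define u where "u = vec n (\<lambda>i. v $ ((i + 1) mod n))"
    have "u \<in> mat_kernel ?A"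
      unfolding kern
    proof (intro conjI allI impI)
      fix i assume i: "i < n"
      have "(\<Sum>s\<in>S. u $ ((i + s) mod n)) = (\<Sum>s\<in>S. v $ (((i + 1) mod n + s) mod n))"
        using n2 by (intro sum.cong) (simp_all add: u_def mod_simps)
      then show "(\<Sum>s\<in>S. u $ ((i + s) mod n)) = 0"
        using v(1) n2 unfolding kern by simp
    qed (simp add: u_def)
    from proportional[OF this i] show ?thesis
      using v0 i n2 by (simp add: u_def c_def field_simps)
  qed
  have pow: "v $ i = c ^ i * v $ 0" if "i < n" for i
    using that
  proof (induction i)
    case (Suc i)
    then show ?case using step[of i] by simp
  qed simp
  obtain m where m: "n = Suc m" using n2 by (cases n) auto
  then have "v $ 0 = c ^ n * v $ 0"
    using step[of m] pow[of m] by simp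
  then have cn: "c ^ n = 1" using v0 by simp
  have sumc: "(\<Sum>s\<in>S. c ^ s) = 0"
  proof -
    have "\<forall>i<n. (\<Sum>s\<in>S. v $ ((i + s) mod n)) = 0" using v(1) unfolding kern by blast
    then have "(\<Sum>s\<in>S. v $ ((0 + s) mod n)) = 0" using n2 by (metis less_le_trans pos2)
    moreover have "(\<Sum>s\<in>S. v $ ((0 + s) mod n)) = (\<Sum>s\<in>S. c ^ s * v $ 0)"
    proof (rule sum.cong)
      fix s assume "s \<in> S"
      then have "s < n" using S0 by auto
      then show "v $ ((0 + s) mod n) = c ^ s * v $ 0" using pow[of s] by simp
    qed simp
    ultimately show ?thesis using v0 by (simp flip: sum_distrib_right)
  qed
  have "\<bar>c\<bar> ^ n = 1" using cn by (metis abs_one power_abs)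
  then have "\<bar>c\<bar> = 1" using power_eq_imp_eq_base[of "\<bar>c\<bar>" n 1] n2 by simp
  \<comment> \<open>For c = 1 the vanishing sum would equal d.\<close>
  moreover have "c \<noteq> 1" using sumc d cardS by auto
  ultimately have c: "c = -1" by linarith
  have even: "even n" using cn c by (cases "even n") auto
  have alt: "(\<Sum>s\<in>S. (-1) ^ s :: int) = 0"
  proof -
    have "real_of_int (\<Sum>s\<in>S. (-1) ^ s) = 0" using sumc by (simp add: c)
    then show ?thesis by (simp only: of_int_eq_0_iff)
  qed
  have "z = -1" if z: "z ^ n = 1" "(\<Sum>s\<in>S. z ^ s) = 0" for z :: complex
  proof -
    \<comment> \<open>Real parts give a real kernel vector. Comparing entries 0 and 1 yields Re z =
      -1, and on the unit circle this leaves only z = -1.\<close>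
    define u where "u = vec n (\<lambda>i. Re (z ^ i))"
    have "u \<in> mat_kernel ?A"
      unfolding kern
    proof (intro conjI allI impI)
      fix i assume i: "i < n"
      have "(\<Sum>s\<in>S. u $ ((i + s) mod n)) = (\<Sum>s\<in>S. Re (z ^ i * z ^ s))"
        using n2 by (intro sum.cong) (simp_all add: u_def power_mod_root[OF z(1)] power_add del: times_complex.sel)
      also have "\<dots> = Re (z ^ i * (\<Sum>s\<in>S. z ^ s))"
        by (simp only: sum_distrib_left Re_sum)
      finally show "(\<Sum>s\<in>S. u $ ((i + s) mod n)) = 0" by (simp add: z)
    qed (simp add: u_def)
    from proportional[OF this, of 1] have "v $ 0 * (Re z + 1) = 0"
      using pow[of 1] n2 by (simp add: u_def c algebra_simps)
    then have "Re z = -1" using v0 by simp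
    moreover have "norm z = 1"
      using power_eq_imp_eq_base[of "norm z" n 1] z(1) n2 by (simp flip: norm_power)
    ultimately show ?thesis
      by (simp add: complex_eq_iff cmod_def)
  qed
  then show ?thesis using that S cardS d even alt by blast
qed

section \<open>Folding the connection set\<close>

text \<open>Since w is its own inverse, z^(h-s) = w * z^(-s), and likewise for the inverse. Thus the
  contributions of s and h - s cancel for w = -1 and agree for w = 1.\<close>

lemma cs_reflect:
  assumes "z ^ h = w" "z \<noteq> 0" "w\<^sup>2 = 1" "s \<le> h"
  shows "cs z (h - s) = w * cs z s"
proof -
  have "w \<noteq> 0" and w: "inverse w = w" using assms(3) by (auto simp: inverse_unique power2_eq_square)
  have "z ^ (h - s) = w * inverse z ^ s"
    using assms by (simp add: power_diff power_inverse divide_inverse)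
  moreover have "inverse z ^ (h - s) = w * z ^ s"
    using assms w by (simp add: power_diff power_inverse divide_inverse)
  ultimately show ?thesis by (simp add: cs_def algebra_simps)
qed

lemma root_inverse_power:
  fixes z :: "'a :: field"
  assumes "z ^ n = 1" "s \<le> n"
  shows "z ^ (n - s) = inverse z ^ s"
proof -
  have "z ^ (n - s) * z ^ s = 1" using assms by (simp flip: power_add)
  then show ?thesis by (metis inverse_unique mult.commute power_inverse)
qed

text \<open>The connection set is T together with its negatives modulo 2 * h. As T lies strictly
  between 0 and h, the two halves are disjoint, and h itself is left out.\<close>

lemma circulant_nut_orders_foldI:
  assumes T: "T \<subseteq> {1..<h}" "T \<noteq> {}" and alt: "(\<Sum>s\<in>T. (-1) ^ s :: int) = 0"
    and nz: "\<And>z :: complex. z ^ (2 * h) = 1 \<Longrightarrow> z \<noteq> 1 \<Longrightarrow> z \<noteq> -1 \<Longrightarrow> (\<Sum>s\<in>T. cs z s) \<noteq> 0"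
  shows "2 * h \<in> circulant_nut_orders (2 * card T)"
proof -
  have fin: "finite T" using T(1) by (rule finite_subset) auto
  have lt: "s < h" "0 < s" if "s \<in> T" for s using that T(1) by auto
  let ?r = "\<lambda>s. 2 * h - s"
  define S where "S = T \<union> ?r ` T"
  have inj: "inj_on ?r T" by (rule inj_onI) (use lt in fastforce)
  have disj: "T \<inter> ?r ` T = {}"
  proof -
    have False if "x \<in> T" "y \<in> T" "x = 2 * h - y" for x y
      using lt[OF that(1)] lt[OF that(2)] that(3) by simp
    then show ?thesis by blast
  qed
  have sumS: "sum f S = (\<Sum>s\<in>T. f s) + (\<Sum>s\<in>T. f (2 * h - s))" for f :: "nat \<Rightarrow> 'b :: comm_monoid_add"
    unfolding S_def using fin inj disj by (simp add: sum.union_disjoint sum.reindex)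
  have "card S = 2 * card T"
    unfolding S_def using fin inj disj by (simp add: card_Un_disjoint card_image)
  moreover have "2 * h \<in> circulant_nut_orders (card S)"
  proof (rule circulant_nut_ordersI)
    show "S \<subseteq> {1..<2 * h}" unfolding S_def using lt by force
    show "2 * h - s \<in> S" if "s \<in> S" for s using that lt by (force simp: S_def)
    show "S \<noteq> {}" using T(2) by (simp add: S_def)
    have "(\<Sum>s\<in>T. (-1) ^ (2 * h - s) :: int) = (\<Sum>s\<in>T. (-1) ^ s)"
    proof (rule sum.cong)
      fix s assume "s \<in> T"
      then show "(-1) ^ (2 * h - s) = ((-1) ^ s :: int)"
        using lt[of s] by (simp add: minus_one_power_iff)
    qed simp
    then show "(\<Sum>s\<in>S. (-1) ^ s :: int) = 0" unfolding sumS using alt by simp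
    fix z :: complex assume z: "z ^ (2 * h) = 1" "z \<noteq> 1" "z \<noteq> -1"
    have "(\<Sum>s\<in>T. z ^ (2 * h - s)) = (\<Sum>s\<in>T. inverse z ^ s)"
      using lt by (intro sum.cong root_inverse_power[OF z(1)]) (auto dest: lt intro: less_imp_le trans_le_add1 simp: mult_2)
    then have "(\<Sum>s\<in>S. z ^ s) = (\<Sum>s\<in>T. cs z s)"
      unfolding sumS by (simp add: cs_def sum.distrib)
    then show "(\<Sum>s\<in>S. z ^ s) \<noteq> 0" using nz[OF z] by simp
  qed simp
  ultimately show ?thesis by simp
qed

lemma sum_alternating:
  assumes "finite T"
  shows "(\<Sum>s\<in>T. (-1) ^ s :: int) = int (card {s \<in> T. even s}) - int (card {s \<in> T. odd s})"
proof -
  have "(\<Sum>s\<in>T. (-1) ^ s :: int) = (\<Sum>s\<in>T. (if even s then 1 else 0) - (if odd s then 1 else 0))"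
    by (intro sum.cong) auto
  also have "\<dots> = (\<Sum>s\<in>{s \<in> T. even s}. 1) - (\<Sum>s\<in>{s \<in> T. odd s}. 1)"
    unfolding sum_subtractf using assms by (simp only: sum.inter_filter)
  finally show ?thesis by simp
qed

lemma card_even_odd:
  assumes "finite T"
  shows "card T = card {s \<in> T. even s} + card {s \<in> T. odd s}"
proof -
  have "T = {s \<in> T. even s} \<union> {s \<in> T. odd s}" by auto
  then show ?thesis using assms by (metis (mono_tags, lifting) card_Un_disjoint disjoint_iff finite_Un mem_Collect_eq)
qed

text \<open>The connection set splits into its lower half T, the mirror image of T and possibly the
  midpoint h. The balance of parities rules out h and makes the two parity classes of T equally
  large.\<close>

lemma circulant_nut_orders_foldD:
  assumes "n \<in> circulant_nut_orders d"
  obtains T h where "n = 2 * h" "T \<subseteq> {1..<h}" "d > 0" "d = 4 * card {s \<in> T. even s}"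
    "card {s \<in> T. even s} = card {s \<in> T. odd s}"
    "\<And>z :: complex. z ^ n = 1 \<Longrightarrow> (\<Sum>s\<in>T. cs z s) = 0 \<Longrightarrow> z = -1"
proof -
  obtain S where S: "S \<subseteq> {1..<n}" "\<And>s. s \<in> S \<Longrightarrow> n - s \<in> S" "card S = d" "d > 0" "even n"
    "(\<Sum>s\<in>S. (-1) ^ s :: int) = 0"
    and zero: "\<And>z :: complex. z ^ n = 1 \<Longrightarrow> (\<Sum>s\<in>S. z ^ s) = 0 \<Longrightarrow> z = -1"
    using circulant_nut_ordersD[OF assms] by blast
  have finS: "finite S" using S(1) by (rule finite_subset) auto
  obtain h where n: "n = 2 * h" using S(5) by blast
  define T where "T = {s \<in> S. s < h}"
  define H where "H = {s \<in> S. s = h}"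
  let ?r = "\<lambda>s. n - s"
  have TS: "T \<subseteq> {1..<h}" using S(1) by (auto simp: T_def)
  have fin: "finite T" using finS by (simp add: T_def)
  \<comment> \<open>The predicate is kept general so that one decomposition counts all of S as well
    as each parity class.\<close>
  have split: "{s \<in> S. P s} = {s \<in> T. P s} \<union> ?r ` {s \<in> T. P s} \<union> {s \<in> H. P s}"
    if P: "\<And>s. s \<le> n \<Longrightarrow> P (n - s) = P s" for P
  proof
    show "{s \<in> S. P s} \<subseteq> {s \<in> T. P s} \<union> ?r ` {s \<in> T. P s} \<union> {s \<in> H. P s}"
    proof
      fix s assume s: "s \<in> {s \<in> S. P s}"
      then have "s < n" using S(1) by auto
      consider "s < h" | "s = h" | "s > h" by linarith
      then show "s \<in> {s \<in> T. P s} \<union> ?r ` {s \<in> T. P s} \<union> {s \<in> H. P s}"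
      proof cases
        case 3
        have "n - s \<in> {s \<in> T. P s}" using 3 s S(2) P[of s] \<open>s < n\<close> n by (auto simp: T_def)
        moreover have "s = n - (n - s)" using \<open>s < n\<close> by simp
        ultimately show ?thesis by blast
      qed (use s in \<open>auto simp: T_def H_def\<close>)
    qed
    show "{s \<in> T. P s} \<union> ?r ` {s \<in> T. P s} \<union> {s \<in> H. P s} \<subseteq> {s \<in> S. P s}"
      using S(2) P n by (auto simp: T_def H_def)
  qed
  have inj: "inj_on ?r {s \<in> T. P s}" for P
    by (rule inj_onI) (use TS n in fastforce)
  have disj: "{s \<in> T. P s} \<inter> ?r ` {s \<in> T. P s} = {}"
    "({s \<in> T. P s} \<union> ?r ` {s \<in> T. P s}) \<inter> {s \<in> H. P s} = {}" for P
    using n TS by (fastforce simp: T_def H_def)+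
  have finH: "finite H" using finS by (simp add: H_def)
  have cardP: "card {s \<in> S. P s} = 2 * card {s \<in> T. P s} + card {s \<in> H. P s}"
    if P: "\<And>s. s \<le> n \<Longrightarrow> P (n - s) = P s" for P
  proof -
    have "card {s \<in> S. P s} = card ({s \<in> T. P s} \<union> ?r ` {s \<in> T. P s} \<union> {s \<in> H. P s})"
      by (rule arg_cong[where f = card, OF split[of P, OF P]])
    also have "\<dots> = card ({s \<in> T. P s} \<union> ?r ` {s \<in> T. P s}) + card {s \<in> H. P s}"
      using fin finH by (intro card_Un_disjoint disj) auto
    also have "card ({s \<in> T. P s} \<union> ?r ` {s \<in> T. P s}) =
        card {s \<in> T. P s} + card (?r ` {s \<in> T. P s})"
      using fin by (intro card_Un_disjoint disj) auto
    finally show ?thesis by (simp add: card_image[OF inj])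
  qed
  have par: "even (n - s) = even s" "odd (n - s) = odd s" if "s \<le> n" for s
    using that n by auto
  have eq: "card {s \<in> S. even s} = card {s \<in> S. odd s}"
    using S(6) finS by (simp add: sum_alternating)
  \<comment> \<open>The involution \<open>s \<mapsto> n - s\<close> preserves parity and fixes at most \<open>h\<close>, so \<open>h \<in> S\<close> would make exactly
    one of the two classes odd.\<close>
  have "H = {}"
  proof (rule ccontr)
    assume "H \<noteq> {}"
    then have "H = {h}" by (auto simp: H_def)
    then have "{s \<in> H. even s} = (if even h then {h} else {})"
      "{s \<in> H. odd s} = (if even h then {} else {h})" by auto
    then show False using eq cardP[of even] cardP[of odd] par by (simp split: if_splits) presburger+
  qed
  then have ceq: "card {s \<in> T. even s} = card {s \<in> T. odd s}"
    using eq cardP[of even] cardP[of odd] par by simp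
  have "card S = 2 * card T"
    using cardP[of "\<lambda>_. True"] \<open>H = {}\<close> by simp
  then have "d = 4 * card {s \<in> T. even s}"
    using S(3) ceq card_even_odd[OF fin] by simp
  moreover have "z = -1" if z: "z ^ n = 1" "(\<Sum>s\<in>T. cs z s) = 0" for z :: complex
  proof -
    have "S = T \<union> ?r ` T" using split[of "\<lambda>_. True"] \<open>H = {}\<close> by simp
    moreover have "T \<inter> ?r ` T = {}" "inj_on ?r T"
      using disj(1)[of "\<lambda>_. True"] inj[of "\<lambda>_. True"] by simp_all
    ultimately have "(\<Sum>s\<in>S. z ^ s) = (\<Sum>s\<in>T. z ^ s) + (\<Sum>s\<in>T. z ^ (n - s))"
      using fin by (simp add: sum.union_disjoint sum.reindex)
    also have "(\<Sum>s\<in>T. z ^ (n - s)) = (\<Sum>s\<in>T. inverse z ^ s)"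
      using TS n by (intro sum.cong root_inverse_power[OF z(1)]) auto
    also have "(\<Sum>s\<in>T. z ^ s) + (\<Sum>s\<in>T. inverse z ^ s) = 0"
      using z(2) by (simp add: cs_def sum.distrib)
    finally show ?thesis using zero[OF z(1)] by simp
  qed
  ultimately show ?thesis using that n TS S(4) ceq by blast
qed

section \<open>Necessary conditions\<close>

lemma sum_minus_one_atLeastLessThan:
  "odd m \<Longrightarrow> (\<Sum>u\<in>{1..<m}. (-1) ^ u :: complex) = 0"
proof -
  have "(\<Sum>u\<in>{1..<2 * k + 1}. (-1) ^ u :: complex) = 0" for k
    by (induction k) (simp_all add: numeral_2_eq_2)
  then show "odd m \<Longrightarrow> ?thesis" by (auto elim!: oddE)
qed

lemma cs_i_even: "cs \<i> (2 * u) = 2 * (-1) ^ u"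
  by (simp add: cs_def power_mult)

text \<open>Here z is i or -i, and the cosine of an odd multiple of a right angle is zero.\<close>

lemma cs_square_minus_one_odd:
  assumes "z\<^sup>2 = -1" "odd c"
  shows "cs z c = 0"
proof -
  obtain u where "c = 2 * u + 1" using assms(2) by (auto elim: oddE)
  moreover have "z \<noteq> 0" using assms(1) by auto
  then have "inverse z = - z" using assms(1) by (intro inverse_unique) (simp add: power2_eq_square)
  ultimately show ?thesis using assms(1) by (simp add: cs_def power_mult)
qed

lemma card_evens: "card {s \<in> {1..<m}. even s} = (m - 1) div 2"
proof -
  have "{s \<in> {1..<m}. even s} = (\<lambda>u. 2 * u) ` {1..(m - 1) div 2}"
    by (auto elim!: evenE)
  then show ?thesis by (simp add: card_image inj_on_def)
qed

lemma card_odds: "card {s \<in> {1..<m}. odd s} = m div 2"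
proof -
  have "card {1..<m} = card {s \<in> {1..<m}. even s} + card {s \<in> {1..<m}. odd s}"
    by (rule card_even_odd) simp
  then show ?thesis unfolding card_evens by simp
qed

text \<open>Orders that are too small produce a zero other than -1. If T fills
  \<open>{1..<h}\<close>, reflection cancels the sum at every z with z^h = -1. If n = d + 4 and 8
  divides d, then T contains all even numbers below h; at z = i their contributions alternate and
  cancel, and the odd ones vanish.\<close>

lemma circulant_nut_orders_bound:
  assumes "n \<in> circulant_nut_orders d"
  shows "4 dvd d" "d > 0" "even n" "n \<ge> d + 4" "8 dvd d \<Longrightarrow> n \<ge> d + 6"
proof -
  obtain T h where n: "n = 2 * h" and T: "T \<subseteq> {1..<h}" "d > 0" and d: "d = 4 * card {s \<in> T. even s}"
    and eq: "card {s \<in> T. even s} = card {s \<in> T. odd s}"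
    and zero: "\<And>z :: complex. z ^ n = 1 \<Longrightarrow> (\<Sum>s\<in>T. cs z s) = 0 \<Longrightarrow> z = -1"
    using circulant_nut_orders_foldD[OF assms] by blast
  show "4 dvd d" "d > 0" "even n" using T n d by auto
  have fin: "finite T" using T(1) by (rule finite_subset) auto
  have cT: "card T = 2 * card {s \<in> T. even s}" using card_even_odd[OF fin] eq by simp
  have le: "card T \<le> h - 1" using card_mono[OF _ T(1)] by simp
  have h1: "h > 1" using T(2) d cT le by simp
  have "card T \<noteq> h - 1"
  proof
    assume "card T = h - 1"
    then have full: "T = {1..<h}" using T(1) by (intro card_subset_eq) auto
    \<comment> \<open>T has even size, because its parity classes are equally large.\<close>
    have "odd h" using \<open>card T = h - 1\<close> cT h1 by presburger
    have "\<exists>w. w \<in> {w :: complex. w ^ h = 1} \<and> w \<noteq> 1"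
    proof (rule ccontr)
      assume "\<not> ?thesis"
      then have "{w :: complex. w ^ h = 1} \<subseteq> {1}" by auto
      then have "card {w :: complex. w ^ h = 1} \<le> card {1 :: complex}" by (intro card_mono) auto
      then show False using h1 by (simp add: card_roots_unity_eq)
    qed
    then obtain w :: complex where w: "w ^ h = 1" "w \<noteq> 1" by blast
    \<comment> \<open>As h is odd, \<open>z ^ h = -1\<close>; and z differs from -1 because w
      differs from 1.\<close>
    define z where "z = - w"
    have zh: "z ^ h = -1" using w \<open>odd h\<close> by (simp add: z_def)
    then have z0: "z \<noteq> 0" using h1 by (auto simp: zero_power)
    have "(\<Sum>s\<in>{1..<h}. cs z s) = (\<Sum>s\<in>{1..<h}. cs z (h - s))"
      by (rule sum_reflect[symmetric]) auto
    also have "\<dots> = - (\<Sum>s\<in>{1..<h}. cs z s)"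
      unfolding sum_negf[symmetric]
    proof (rule sum.cong)
      fix s assume "s \<in> {1..<h}"
      then show "cs z (h - s) = - cs z s" using cs_reflect[OF zh z0, of s] by simp
    qed simp
    finally have "(\<Sum>s\<in>T. cs z s) = 0" unfolding full by simp
    moreover have "z ^ n = 1" using zh by (simp add: n mult.commute[of 2 h] power_mult)
    ultimately have "z = -1" using zero by blast
    then show False using w by (simp add: z_def)
  qed
  then show bound: "n \<ge> d + 4" using le cT d n h1 by presburger
  show "n \<ge> d + 6" if "8 dvd d"
  proof (rule ccontr)
    assume "\<not> n \<ge> d + 6"
    then have nd: "n = d + 4" using bound n d by presburger
    define e where "e = card {s \<in> T. even s}"
    have h: "h = 2 * (e + 1)" using nd n d unfolding e_def by presburger
    have ev: "even e" using that d unfolding e_def by presburger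
    \<comment> \<open>T has one element fewer than \<open>{1..<h}\<close>. There the odd numbers
      exceed the even ones by one, so the missing element is odd.\<close>
    have evens: "{s \<in> T. even s} = {s \<in> {1..<h}. even s}"
    proof (rule card_subset_eq)
      show "card {s \<in> T. even s} = card {s \<in> {1..<h}. even s}" unfolding card_evens using h e_def by simp
    qed (use T(1) in auto)
    have "\<i> ^ n = 1"
    proof -
      have "n = 4 * (e + 1)" using n h by simp
      then show ?thesis by (simp only: power_mult) simp
    qed
    moreover have "(\<Sum>s\<in>T. cs \<i> s) = 0"
    proof -
      have "(\<Sum>s\<in>T. cs \<i> s) = (\<Sum>s\<in>{s \<in> T. even s}. cs \<i> s)"
        using fin by (intro sum.mono_neutral_right) (auto intro: cs_square_minus_one_odd)
      also have "\<dots> = (\<Sum>u\<in>{1..<e + 1}. cs \<i> (2 * u))"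
        unfolding evens
        by (rule sum.reindex_bij_witness[where i = "\<lambda>u. 2 * u" and j = "\<lambda>s. s div 2"])
          (use h in auto)
      also have "\<dots> = 2 * (\<Sum>u\<in>{1..<e + 1}. (-1) ^ u)"
        by (simp only: cs_i_even sum_distrib_left)
      also have "\<dots> = 0" using ev by (subst sum_minus_one_atLeastLessThan) auto
      finally show ?thesis .
    qed
    ultimately have "\<i> = -1" using zero by blast
    then show False by (simp add: complex_eq_iff)
  qed
qed

text \<open>T consists of two even and two odd numbers below 8. At order 4 the odd ones vanish, so
  the even ones must be 2 and 6. These cancel at orders 16 and 8. Order 16 then forbids the odd
  pairs {1, 7} and {3, 5}, and order 8 forbids all other odd pairs.\<close>

lemma sixteen_notin_circulant_nut_orders_8: "16 \<notin> circulant_nut_orders 8"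
proof
  assume *: "16 \<in> circulant_nut_orders 8"
  show False
  proof (rule circulant_nut_orders_foldD[OF *])
    fix T h assume h: "16 = 2 * h"
      and T: "T \<subseteq> {1..<h}" and d: "8 = 4 * card {s \<in> T. even s}"
      and eq: "card {s \<in> T. even s} = card {s \<in> T. odd s}"
      and zero: "\<And>z :: complex. z ^ 16 = 1 \<Longrightarrow> (\<Sum>s\<in>T. cs z s) = 0 \<Longrightarrow> z = -1"
    have h8: "h = 8" using h by simp
    have set: "{1..<8} = {1, 2, 3, 4, 5, 6, 7 :: nat}" by auto
    have expand: "sum f T = (\<Sum>s\<in>{1, 2, 3, 4, 5, 6, 7}. if s \<in> T then f s else 0)"
      for f :: "nat \<Rightarrow> 'b :: comm_monoid_add"
      unfolding set[symmetric] using T h8 by (intro sum.mono_neutral_cong_left) auto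
    have "card {s \<in> T. even s} = (\<Sum>s\<in>T. if even s then 1 else 0)"
      "card {s \<in> T. odd s} = (\<Sum>s\<in>T. if odd s then 1 else 0)"
      using T finite_subset[of T "{1..<h}"] by (simp_all flip: sum.inter_filter)
    then have card2: "(\<Sum>s\<in>T. if even s then 1 else 0) = (2 :: nat)"
      "(\<Sum>s\<in>T. if odd s then 1 else 0) = (2 :: nat)"
      using d eq by simp_all
    \<comment> \<open>A primitive sixteenth root of unity; its powers \<open>z\<close>,
      \<open>z\<^sup>2\<close> and \<open>z ^ 4\<close> have orders 16, 8 and 4.\<close>
    define z where "z = cis (pi / 8)"
    have z8: "z ^ 8 = -1" by (simp add: z_def DeMoivre)
    then have z0: "z \<noteq> 0" by auto
    have r8: "cs z 4 = 0" "cs z 5 = - cs z 3" "cs z 6 = - cs z 2" "cs z 7 = - cs z 1"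
      using cs_reflect[OF z8 z0, of 4] cs_reflect[OF z8 z0, of 3] cs_reflect[OF z8 z0, of 2]
        cs_reflect[OF z8 z0, of 1] by simp_all
    have z4: "(z\<^sup>2) ^ 4 = -1" using z8 by (simp flip: power_mult)
    have r4: "cs (z\<^sup>2) 2 = 0" "cs (z\<^sup>2) 3 = - cs (z\<^sup>2) 1"
      using cs_reflect[OF z4, of 2] cs_reflect[OF z4, of 1] z0 by simp_all
    have r4': "cs (z\<^sup>2) 5 = - cs (z\<^sup>2) 1" "cs (z\<^sup>2) 6 = 0" "cs (z\<^sup>2) 7 = cs (z\<^sup>2) 1"
    proof -
      have "(z\<^sup>2) ^ 8 = (z ^ 8)\<^sup>2" by (simp flip: power_mult)
      then have "(z\<^sup>2) ^ 8 = 1" by (simp add: z8)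
      note r = cs_reflect[OF this]
      from r[of 3] r[of 2] r[of 1] r4 z0
      show "cs (z\<^sup>2) 5 = - cs (z\<^sup>2) 1" "cs (z\<^sup>2) 6 = 0" "cs (z\<^sup>2) 7 = cs (z\<^sup>2) 1" by simp_all
    qed
    have z2: "(z ^ 4)\<^sup>2 = -1" using z8 by (simp flip: power_mult)
    have r2: "cs (z ^ 4) 1 = 0" "cs (z ^ 4) 3 = 0" "cs (z ^ 4) 5 = 0" "cs (z ^ 4) 7 = 0"
      using cs_square_minus_one_odd[OF z2] by simp_all
    have r2': "cs (z ^ 4) 2 = -2" "cs (z ^ 4) 4 = 2" "cs (z ^ 4) 6 = -2"
    proof -
      have "cs (z ^ 4) (2 * u) = 2 * (-1) ^ u" for u
        using z2 by (simp add: cs_def power_mult power_inverse)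
      from this[of 1] this[of 2] this[of 3]
      show "cs (z ^ 4) 2 = -2" "cs (z ^ 4) 4 = 2" "cs (z ^ 4) 6 = -2" by simp_all
    qed
    have ne: "z \<noteq> -1" "z\<^sup>2 \<noteq> -1" "z ^ 4 \<noteq> -1"
    proof -
      show "z \<noteq> -1" using z8 by auto
      show "z\<^sup>2 \<noteq> -1"
      proof
        assume "z\<^sup>2 = -1"
        from z4[unfolded this] show False by simp
      qed
      show "z ^ 4 \<noteq> -1"
      proof
        assume "z ^ 4 = -1"
        from z2[unfolded this] show False by simp
      qed
    qed
    have z16: "z ^ 16 = 1" "(z\<^sup>2) ^ 16 = 1" "(z ^ 4) ^ 16 = 1"
    proof -
      have "z ^ 16 = (z ^ 8)\<^sup>2" by (simp flip: power_mult)
      then show 1: "z ^ 16 = 1" by (simp add: z8)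
      have "(z\<^sup>2) ^ 16 = (z ^ 16)\<^sup>2" "(z ^ 4) ^ 16 = (z ^ 16) ^ 4" by (simp_all flip: power_mult)
      then show "(z\<^sup>2) ^ 16 = 1" "(z ^ 4) ^ 16 = 1" by (simp_all add: 1)
    qed
    have n1: "(\<Sum>s\<in>T. cs z s) \<noteq> 0" "(\<Sum>s\<in>T. cs (z\<^sup>2) s) \<noteq> 0" "(\<Sum>s\<in>T. cs (z ^ 4) s) \<noteq> 0"
      using zero z16 ne by blast+
    show False
      using card2 n1 unfolding expand
      by (simp add: r8 r4 r4' r2 r2(1)[unfolded One_nat_def] r2' split: if_splits)
  qed
qed

section \<open>Nonvanishing of the eigenvalues\<close>

text \<open>One and the same power evaluates to -1 and to 1. In effect, z^a = -1 and z^b = -1 can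
  hold together only if a and b (both positive) contain the same power of two.\<close>

lemma minus_one_power_conflict:
  fixes z :: "'a :: ring_1"
  assumes "z ^ a = -1" "z ^ b = -1" "a * x = b * y" "odd x" "even y" "(1 :: 'a) \<noteq> -1"
  shows False
proof -
  have "(z ^ a) ^ x = (z ^ b) ^ y" using assms(3) by (simp flip: power_mult)
  then show False using assms by (simp add: minus_one_power_iff)
qed

lemma cs_eq_0_iff:
  assumes "z \<noteq> 0"
  shows "cs z a = 0 \<longleftrightarrow> z ^ (2 * a) = -1"
proof -
  have "z ^ a * cs z a = z ^ (2 * a) + 1"
    using assms by (simp add: cs_def distrib_left power_inverse mult_2 power_add)
  then show ?thesis using assms by (metis add_eq_0_iff2 mult_eq_0_iff power_not_zero)
qed

lemma cs_of_sq_one: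
  assumes "z ^ (2 * a) = 1"
  shows "cs z a = 2 * z ^ a"
proof -
  have "z ^ a * z ^ a = 1" using assms by (simp add: mult_2 power_add)
  then have "inverse (z ^ a) = z ^ a" by (rule inverse_unique)
  then show ?thesis by (simp add: cs_def power_inverse)
qed

section \<open>Base sets completed by reflected pairs\<close>

text \<open>By \<open>cs_reflect\<close> the pairs c, h - c contribute 1 + z^h times the sum over P,
  which is zero in \<open>minus\<close> and twice the sum in \<open>plus\<close>. The bound 2 * c <
  h makes P and its reflection disjoint.\<close>

lemma circulant_nut_orders_pairsI:
  assumes B: "B \<subseteq> {1..<h}" "B \<noteq> {}" and P: "P \<subseteq> {1..<h}" "\<And>c. c \<in> P \<Longrightarrow> 2 * c < h"
    and BP: "B \<inter> P = {}" "B \<inter> (\<lambda>c. h - c) ` P = {}"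
    and alt: "(\<Sum>s\<in>B. (-1) ^ s) + (1 + (-1) ^ h) * (\<Sum>c\<in>P. (-1) ^ c) = (0 :: int)"
    and minus: "\<And>z :: complex. z ^ h = -1 \<Longrightarrow> z \<noteq> -1 \<Longrightarrow> (\<Sum>s\<in>B. cs z s) \<noteq> 0"
    and plus: "\<And>z :: complex. z ^ h = 1 \<Longrightarrow> z \<noteq> 1 \<Longrightarrow> z \<noteq> -1 \<Longrightarrow>
      (\<Sum>s\<in>B. cs z s) + 2 * (\<Sum>c\<in>P. cs z c) \<noteq> 0"
  shows "2 * h \<in> circulant_nut_orders (2 * card B + 4 * card P)"
proof -
  let ?Q = "(\<lambda>c. h - c) ` P"
  have fin: "finite B" "finite P" using B(1) P(1) by (auto intro: finite_subset)
  have lt: "c < h" "0 < c" if "c \<in> P" for c using that P(1) by auto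
  have h0: "h > 0" using B by auto
  have inj: "inj_on (\<lambda>c. h - c) P" by (rule inj_onI) (use lt in fastforce)
  have disj: "P \<inter> ?Q = {}"
  proof -
    have False if "x \<in> P" "y \<in> P" "x = h - y" for x y
      using P(2)[OF that(1)] P(2)[OF that(2)] that(3) by simp
    then show ?thesis by blast
  qed
  have sumT: "sum f (B \<union> (P \<union> ?Q)) = sum f B + (sum f P + (\<Sum>c\<in>P. f (h - c)))"
    for f :: "nat \<Rightarrow> 'b :: comm_monoid_add"
  proof -
    have "sum f (B \<union> (P \<union> ?Q)) = sum f B + sum f (P \<union> ?Q)"
      using fin BP by (intro sum.union_disjoint) auto
    also have "sum f (P \<union> ?Q) = sum f P + sum f ?Q"
      using fin disj by (intro sum.union_disjoint) auto
    finally show ?thesis by (simp add: sum.reindex[OF inj])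
  qed
  have "card (B \<union> (P \<union> ?Q)) = card B + 2 * card P"
    using sumT[of "\<lambda>_. 1 :: nat"] by simp
  moreover have "2 * h \<in> circulant_nut_orders (2 * card (B \<union> (P \<union> ?Q)))"
  proof (rule circulant_nut_orders_foldI)
    show "B \<union> (P \<union> ?Q) \<subseteq> {1..<h}" using B(1) P(1) lt by force
    show "B \<union> (P \<union> ?Q) \<noteq> {}" using B(2) by auto
    have "(\<Sum>c\<in>P. (-1) ^ (h - c)) = (-1) ^ h * (\<Sum>c\<in>P. (-1) ^ c :: int)"
      unfolding sum_distrib_left
    proof (rule sum.cong)
      fix c assume "c \<in> P"
      then show "(-1) ^ (h - c) = (-1) ^ h * ((-1) ^ c :: int)"
        using lt[of c] by (simp add: minus_one_power_iff)
    qed simp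
    then show "(\<Sum>s\<in>B \<union> (P \<union> ?Q). (-1) ^ s) = (0 :: int)"
      using alt unfolding sumT by (simp add: algebra_simps)
    fix z :: complex assume z: "z ^ (2 * h) = 1" "z \<noteq> 1" "z \<noteq> -1"
    then have z0: "z \<noteq> 0" using h0 by (auto simp: zero_power)
    have "(z ^ h)\<^sup>2 = 1" using z(1) by (simp add: mult.commute[of 2 h] power_mult)
    then have w: "z ^ h = 1 \<or> z ^ h = -1" by (simp add: power2_eq_1_iff)
    have "(\<Sum>c\<in>P. cs z (h - c)) = z ^ h * (\<Sum>c\<in>P. cs z c)"
      unfolding sum_distrib_left
    proof (rule sum.cong)
      fix c assume "c \<in> P"
      then show "cs z (h - c) = z ^ h * cs z c"
        using lt[of c] w z0 by (intro cs_reflect) auto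
    qed simp
    then have "(\<Sum>s\<in>B \<union> (P \<union> ?Q). cs z s) = (\<Sum>s\<in>B. cs z s) + (1 + z ^ h) * (\<Sum>c\<in>P. cs z c)"
      unfolding sumT by (simp add: algebra_simps)
    then show "(\<Sum>s\<in>B \<union> (P \<union> ?Q). cs z s) \<noteq> 0"
      using w plus[of z] minus[of z] z by auto
  qed
  ultimately show ?thesis by (simp add: algebra_simps)
qed

lemma sum_cs_cyc:
  assumes "z ^ n = 1" "n > 0"
  shows "(\<Sum>c\<in>A. cs z c) \<in> cyc z"
  using assms by (intro cyc_sum cs_cyc cyc_self cyc_inverse)

text \<open>This converts a vanishing eigenvalue into divisibility of its base part by two.\<close>

lemma ev_of_add_eq_0:
  assumes "x + 2 * y = 0" "y \<in> cyc z"
  shows "x \<in> ev z"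
proof -
  have "x = 2 * (- y)" using assms(1) by (simp add: add_eq_0_iff2)
  then show ?thesis using assms(2) by (simp only: evI cyc_uminus)
qed

text \<open>As h is odd, each pair c, h - c is already balanced in parity, and so is the base {m, m
  - 1}. If z^h = 1, then z has odd order and the base contributes a unit; if z^h = -1, the
  sum-to-product formula shows that it is nonzero.\<close>

lemma circulant_nut_orders_odd_half:
  assumes h: "h = 2 * m + 1" and e: "e + 2 \<le> m"
  shows "2 * h \<in> circulant_nut_orders (4 + 4 * e)"
proof -
  let ?B = "{m, m - 1}"
  have "2 * h \<in> circulant_nut_orders (2 * card ?B + 4 * card {1..<e + 1})"
  proof (rule circulant_nut_orders_pairsI)
    show "?B \<subseteq> {1..<h}" "?B \<noteq> {}" using h e by auto
    show "{1..<e + 1} \<subseteq> {1..<h}" "\<And>c. c \<in> {1..<e + 1} \<Longrightarrow> 2 * c < h" using h e by auto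
    show "?B \<inter> {1..<e + 1} = {}" "?B \<inter> (\<lambda>c. h - c) ` {1..<e + 1} = {}" using h e by auto
    have neq: "m \<noteq> m - 1" using e by simp
    obtain r where r: "m = Suc r" using e by (cases m) auto
    \<comment> \<open>The exponent m + (m - 1) in the sum-to-product formula is h - 2; comparing its
      power with z^h reduces both cases to z^2 = 1.\<close>
    have hm: "h = m + (m - 1) + 2" using h r by simp
    have zh: "z ^ h = z ^ (m + (m - 1)) * z\<^sup>2" for z :: complex by (simp only: hm power_add)
    show "(\<Sum>s\<in>?B. (-1) ^ s) + (1 + (-1) ^ h) * (\<Sum>c\<in>{1..<e + 1}. (-1) ^ c) = (0 :: int)"
      using neq by (simp add: h r)
    fix z :: complex
    have sumB: "(\<Sum>s\<in>?B. cs z s) = cs z m + cs z (m - 1)" using neq by simp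
    {
      assume z: "z ^ h = -1" "z \<noteq> -1"
      then have z0: "z \<noteq> 0" using h by auto
      show "(\<Sum>s\<in>?B. cs z s) \<noteq> 0"
      proof
        assume "(\<Sum>s\<in>?B. cs z s) = 0"
        then have "(1 + z ^ (m + (m - 1))) * (1 + z ^ (m - (m - 1))) = 0"
          using cs_add_cs[OF z0, of "m - 1" m] sumB by simp
        then have "z ^ (m + (m - 1)) = -1"
          using z(2) e by (auto simp: add_eq_0_iff)
        then have "z\<^sup>2 = 1" using z(1) zh[of z] by simp
        then show False using z h by (auto simp: power2_eq_1_iff)
      qed
    next
      assume z: "z ^ h = 1" "z \<noteq> 1" "z \<noteq> -1"
      have h0: "h > 0" "odd h" using h by auto
      have "z ^ (m + (m - 1)) \<noteq> 1"
      proof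
        assume "z ^ (m + (m - 1)) = 1"
        then have "z\<^sup>2 = 1" using z(1) zh[of z] by simp
        then show False using z by (simp add: power2_eq_1_iff)
      qed
      moreover have "z ^ (m - (m - 1)) \<noteq> 1" using z e by simp
      ultimately have "cs z m + cs z (m - 1) \<notin> ev z"
        using double_cs_not_ev[OF z(1) h0(1) cyc_self cyc_inverse[OF z(1) h0(1)] z(1) h0(2)] by simp
      then show "(\<Sum>s\<in>?B. cs z s) + 2 * (\<Sum>c\<in>{1..<e + 1}. cs z c) \<noteq> 0"
        using ev_of_add_eq_0[OF _ sum_cs_cyc[OF z(1) h0(1)]] sumB by metis
    }
  qed
  moreover have "card ?B = 2" using e by simp
  ultimately show ?thesis by simp
qed

section \<open>Orders divisible by four\<close>

text \<open>The numbers \<open>e\<close> and \<open>f\<close> count the pairs \<open>{c, 2 * k - c}\<close> with even and with odd \<open>c\<close>; the set \<open>X\<close>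
  contains the numbers below \<open>k\<close> that are unavailable because their pair meets \<open>B\<close>.\<close>
lemma circulant_nut_orders_even_half:
  assumes B: "B \<subseteq> {1..<2 * k}" "B \<noteq> {}" and X: "finite X" "B \<inter> {1..<k} \<subseteq> X"
    "(\<lambda>b. 2 * k - b) ` B \<inter> {1..<k} \<subseteq> X"
    and e: "card {c \<in> X. even c} + e \<le> (k - 1) div 2" and f: "card {c \<in> X. odd c} + f \<le> k div 2"
    and alt: "(\<Sum>s\<in>B. (-1) ^ s) + 2 * (int e - int f) = 0"
    and minus: "\<And>z :: complex. z ^ (2 * k) = -1 \<Longrightarrow> z \<noteq> -1 \<Longrightarrow> (\<Sum>s\<in>B. cs z s) \<noteq> 0"
    and plus: "\<And>(z :: complex) E F. z ^ (2 * k) = 1 \<Longrightarrow> z\<^sup>2 \<noteq> 1 \<Longrightarrow>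
      finite E \<Longrightarrow> finite F \<Longrightarrow> Ball E even \<Longrightarrow> Ball F odd \<Longrightarrow> card E = e \<Longrightarrow> card F = f \<Longrightarrow>
      (\<Sum>s\<in>B. cs z s) + 2 * ((\<Sum>c\<in>E. cs z c) + (\<Sum>c\<in>F. cs z c)) \<noteq> 0"
    and d: "d = 2 * card B + 4 * (e + f)"
  shows "4 * k \<in> circulant_nut_orders d"
proof -
  \<comment> \<open>The range \<open>{1..<k}\<close> has (k - 1) div 2 even and k div 2 odd numbers,
    enough for e and f after removal of X. Any choice will do, as \<open>plus\<close> quantifies
    over all E and F of these sizes.\<close>
  have "e \<le> card ({c \<in> {1..<k}. even c} - {c \<in> X. even c})"
    using diff_card_le_card_Diff[of "{c \<in> X. even c}" "{c \<in> {1..<k}. even c}"] X(1) e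
    unfolding card_evens by simp
  then obtain E where E: "E \<subseteq> {c \<in> {1..<k}. even c} - {c \<in> X. even c}" "card E = e" "finite E"
    by (rule obtain_subset_with_card_n)
  have "f \<le> card ({c \<in> {1..<k}. odd c} - {c \<in> X. odd c})"
    using diff_card_le_card_Diff[of "{c \<in> X. odd c}" "{c \<in> {1..<k}. odd c}"] X(1) f
    unfolding card_odds by simp
  then obtain F where F: "F \<subseteq> {c \<in> {1..<k}. odd c} - {c \<in> X. odd c}" "card F = f" "finite F"
    by (rule obtain_subset_with_card_n)
  have EF: "E \<inter> F = {}" and par: "Ball E even" "Ball F odd" using E(1) F(1) by auto
  have sumP: "sum g (E \<union> F) = sum g E + sum g F" for g :: "nat \<Rightarrow> 'b :: comm_monoid_add"
    using E(3) F(3) EF by (rule sum.union_disjoint)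
  have PX: "c \<in> {1..<k}" "c \<notin> X" if "c \<in> E \<union> F" for c using that E(1) F(1) by auto
  have "2 * (2 * k) \<in> circulant_nut_orders (2 * card B + 4 * card (E \<union> F))"
  proof (rule circulant_nut_orders_pairsI)
    show "E \<union> F \<subseteq> {1..<2 * k}" using PX(1) by fastforce
    show "2 * c < 2 * k" if "c \<in> E \<union> F" for c using PX(1)[OF that] by simp
    show "B \<inter> (E \<union> F) = {}" using PX X(2) by blast
    have False if "b \<in> B" "c \<in> E \<union> F" "b = 2 * k - c" for b c
    proof -
      have "2 * k - b = c" using PX(1)[OF that(2)] that(3) by simp
      then show False using PX[OF that(2)] X(3) that(1) by blast
    qed
    then show "B \<inter> (\<lambda>c. 2 * k - c) ` (E \<union> F) = {}" by blast
    have "(\<Sum>c\<in>E. (-1) ^ c :: int) = int e" "(\<Sum>c\<in>F. (-1) ^ c :: int) = - int f"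
      using par E(2) F(2) by simp_all
    then show "(\<Sum>s\<in>B. (-1) ^ s) + (1 + (-1) ^ (2 * k)) * (\<Sum>c\<in>E \<union> F. (-1) ^ c) = (0 :: int)"
      using alt unfolding sumP by simp
    show "(\<Sum>s\<in>B. cs z s) + 2 * (\<Sum>c\<in>E \<union> F. cs z c) \<noteq> 0"
      if "z ^ (2 * k) = 1" "z \<noteq> 1" "z \<noteq> -1" for z
      using plus[OF that(1) _ E(3) F(3) par E(2) F(2)] that(2,3) unfolding sumP
      by (simp add: power2_eq_1_iff)
  qed (use B minus in auto)
  moreover have "card (E \<union> F) = e + f" using E F EF by (simp add: card_Un_disjoint)
  ultimately show ?thesis by (simp add: d)
qed

section \<open>Parity arguments at roots of 2-power order\<close>

text \<open>Each even exponent contributes 2 or -2, so half the sum has the parity of the number of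
  terms.\<close>

lemma sum_cs_order_4:
  assumes "z\<^sup>2 = -1" "finite E" "Ball E even"
  shows "\<exists>N. (\<Sum>c\<in>E. cs z c) = 2 * of_int N \<and> even N = even (card E)"
  using assms(2,3)
proof (induction E)
  case (insert c E)
  then obtain N where N: "(\<Sum>c\<in>E. cs z c) = 2 * of_int N" "even N = even (card E)" by auto
  obtain u where "c = 2 * u" using insert.prems by auto
  then have "cs z c = 2 * of_int ((-1) ^ u)"
    using assms(1) by (simp add: cs_def power_mult power_inverse)
  then have "(\<Sum>c\<in>insert c E. cs z c) = 2 * of_int ((-1) ^ u + N)"
    using insert.hyps N(1) by simp
  moreover have "even ((-1) ^ u + N) = even (card (insert c E))"
    using insert.hyps N(2) by simp
  ultimately show ?case by blast
qed auto

text \<open>Odd exponents contribute zero, and the total is 4 * (q + N), where N has the parity of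
  \<open>card E\<close>; hence q + N is odd.\<close>

lemma sum_cs_order_4_nonzero:
  assumes z: "z\<^sup>2 = -1" and E: "finite E" "Ball E even" and F: "Ball F odd"
    and q: "x = 4 * of_int q" "odd (q + int (card E))"
  shows "x + 2 * ((\<Sum>c\<in>E. cs z c) + (\<Sum>c\<in>F. cs z c)) \<noteq> 0"
proof
  assume *: "x + 2 * ((\<Sum>c\<in>E. cs z c) + (\<Sum>c\<in>F. cs z c)) = 0"
  obtain N where N: "(\<Sum>c\<in>E. cs z c) = 2 * of_int N" "even N = even (card E)"
    using sum_cs_order_4[OF z E] by blast
  have "(\<Sum>c\<in>F. cs z c) = 0"
    using F cs_square_minus_one_odd[OF z] by (intro sum.neutral) auto
  then have "(of_int (4 * (q + N)) :: complex) = of_int 0" using * N(1) q(1) by simp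
  then have "4 * (q + N) = 0" by (simp only: of_int_eq_iff)
  then have "N = - q" by simp
  then show False using N(2) q(2) by simp
qed

text \<open>Raising an exponent by 4 flips the sign, so even exponents contribute 0, 2 or -2, and
  odd ones plus or minus \<open>cs z 1\<close>, whose square is 2. A vanishing sum would give M^2 =
  2 * N^2 with M odd.\<close>

lemma sum_cs_order_8_nonzero:
  assumes z: "z ^ 4 = -1" and E: "finite E" "Ball E even" and F: "finite F" "Ball F odd"
    and odd: "odd (card F)"
  shows "(\<Sum>c\<in>E. cs z c) + (\<Sum>c\<in>F. cs z c) \<noteq> 0"
proof
  assume *: "(\<Sum>c\<in>E. cs z c) + (\<Sum>c\<in>F. cs z c) = 0"
  have z0: "z \<noteq> 0" using z by auto
  have inv: "inverse z ^ 4 = -1" using z by (simp add: power_inverse)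
  have per: "cs z (c + 4) = - cs z c" for c
    by (simp add: cs_def power_add z inv)
  have red: "cs z (4 * q + r) = (-1) ^ q * cs z r" for q r
  proof (induction q)
    case (Suc q)
    have "4 * Suc q + r = (4 * q + r) + 4" by simp
    then show ?case using per[of "4 * q + r"] Suc.IH by (simp only: power_Suc) simp
  qed simp
  have small: "cs z 0 = 2" "cs z 2 = 0" "cs z 3 = - cs z 1"
    using cs_reflect[OF z z0, of 2] cs_reflect[OF z z0, of 1] by (simp_all add: cs_def[of z 0])
  have Ev: "\<exists>N. (\<Sum>c\<in>E. cs z c) = 2 * of_int N" using E
  proof (induction E)
    case (insert c E)
    then obtain N where N: "(\<Sum>c\<in>E. cs z c) = 2 * of_int N" by auto
    have "even c" using insert.prems by simp
    then have "c mod 4 = 0 \<or> c mod 4 = 2" by presburger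
    then have "cs z (c mod 4) = 2 \<or> cs z (c mod 4) = 0" using small by auto
    then obtain M where "cs z c = 2 * of_int M"
      using red[of "c div 4" "c mod 4"] that[of "(-1) ^ (c div 4)"] that[of 0] by auto
    then have "(\<Sum>c\<in>insert c E. cs z c) = 2 * of_int (M + N)" using insert.hyps N by simp
    then show ?case by blast
  qed (auto intro: exI[of _ 0])
  have Od: "\<exists>N. (\<Sum>c\<in>F. cs z c) = of_int N * cs z 1 \<and> even N = even (card F)" using F
  proof (induction F)
    case (insert c F)
    then obtain N where N: "(\<Sum>c\<in>F. cs z c) = of_int N * cs z 1" "even N = even (card F)" by auto
    have "odd c" using insert.prems by simp
    then have "c mod 4 = 1 \<or> c mod 4 = 3" by presburger
    then have "cs z (c mod 4) = cs z 1 \<or> cs z (c mod 4) = - cs z 1" using small by auto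
    then obtain M :: int where M: "cs z c = of_int M * cs z 1" "odd M"
      using red[of "c div 4" "c mod 4"] that[of "(-1) ^ (c div 4)"] that[of "- ((-1) ^ (c div 4))"]
      by auto
    then have "(\<Sum>c\<in>insert c F. cs z c) = of_int (M + N) * cs z 1"
      using insert.hyps N by (simp add: algebra_simps)
    moreover have "even (M + N) = even (card (insert c F))" using insert.hyps N(2) M(2) by simp
    ultimately show ?case by blast
  qed (auto intro: exI[of _ 0])
  obtain N M where N: "(\<Sum>c\<in>E. cs z c) = 2 * of_int N"
    and M: "(\<Sum>c\<in>F. cs z c) = of_int M * cs z 1" "even M = even (card F)"
    using Ev Od by blast
  have "(cs z 1)\<^sup>2 = cs (z\<^sup>2) 1 + 2" using cs_square[OF z0] .
  also have "cs (z\<^sup>2) 1 = 0" using small(2) by (simp add: cs_power)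
  finally have sq: "(cs z 1)\<^sup>2 = 2" by simp
  have "of_int M * cs z 1 = - (2 * of_int N)" using * N M(1) by (simp add: add_eq_0_iff)
  then have "(of_int M * cs z 1)\<^sup>2 = (2 * of_int N)\<^sup>2" by simp
  then have "of_int (M\<^sup>2 * 2) = (of_int (4 * N\<^sup>2) :: complex)"
    using sq by (simp add: power_mult_distrib)
  then have "M\<^sup>2 * 2 = 4 * N\<^sup>2" by (simp only: of_int_eq_iff)
  then have "M\<^sup>2 = 2 * N\<^sup>2" by simp
  then have "even (M\<^sup>2)" by simp
  then show False using M(2) odd by simp
qed

text \<open>As \<open>cs z k = 2 * z ^ k\<close>, a zero makes \<open>cs z (2 ^ g)\<close> divisible
  by two, so \<open>z ^ (4 * 2 ^ g) = 1\<close> by \<open>cs_not_ev\<close>. If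
  \<open>z ^ (2 * 2 ^ g)\<close> were -1, that term would vanish, and half of the rest would
  contradict \<open>cs_sum_2power_nonzero\<close>.\<close>

lemma single_base_zero:
  assumes z: "z ^ (2 * k) = 1" and k: "k > 0" and fin: "finite E" "finite F" "E \<inter> F = {}"
    and zero: "cs z (2 ^ g) + cs z k + 2 * ((\<Sum>c\<in>E. cs z c) + (\<Sum>c\<in>F. cs z c)) = 0"
  shows "z ^ (2 * 2 ^ g) = 1"
proof -
  have z0: "z \<noteq> 0" using root_of_unity_nonzero[OF z] k by simp
  have k2: "2 * k > 0" using k by simp
  let ?s = "(\<Sum>c\<in>E. cs z c) + (\<Sum>c\<in>F. cs z c)"
  have eq: "cs z (2 ^ g) + 2 * (z ^ k + ?s) = 0"
    using zero cs_of_sq_one[OF z] by (simp add: algebra_simps)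
  have "z ^ k + ?s \<in> cyc z"
    using sum_cs_cyc[OF z k2] by (intro cyc_add cyc_power cyc_self)
  from ev_of_add_eq_0[OF eq this] have "z ^ (4 * 2 ^ g) = 1"
    using cs_not_ev[OF z k2] by blast
  then have "(z ^ (2 * 2 ^ g))\<^sup>2 = 1" by (simp add: power_mult[symmetric] mult.commute)
  moreover have "z ^ (2 * 2 ^ g) \<noteq> -1"
  proof
    assume "z ^ (2 * 2 ^ g) = -1"
    then have "cs z (2 ^ g) = 0" using cs_eq_0_iff[OF z0] by blast
    then have "z ^ k + ?s = 0" using eq by (metis add_0 mult_eq_0_iff zero_neq_numeral)
    then have "z ^ k + (\<Sum>c\<in>E \<union> F. cs z c) = 0"
      using fin by (simp add: sum.union_disjoint)
    moreover have "z ^ 2 ^ (g + 2) = 1" using \<open>z ^ (4 * 2 ^ g) = 1\<close> by (simp add: mult.commute)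
    ultimately show False using cs_sum_2power_nonzero fin by blast
  qed
  ultimately show ?thesis by (simp add: power2_eq_1_iff)
qed

lemma square_minus_one_of_power4:
  fixes z :: complex
  assumes "z ^ 4 = 1" "z\<^sup>2 \<noteq> 1"
  shows "z\<^sup>2 = -1"
proof -
  have "(z\<^sup>2)\<^sup>2 = 1" using assms(1) by (simp flip: power_mult)
  then show ?thesis using assms(2) unfolding power2_eq_1_iff[of "z\<^sup>2"] by blast
qed

lemma power_mult_eqI:
  fixes z :: "'a :: monoid_mult"
  assumes "z ^ a = w" "b = a * c"
  shows "z ^ b = w ^ c"
  using assms by (simp add: power_mult)

lemma cs_half_eq_0:
  assumes "z ^ (2 * k) = -1" "k > 0"
  shows "cs z k = 0"
proof -
  have "z \<noteq> 0" using assms by (auto simp: zero_power)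
  then show ?thesis using assms(1) cs_eq_0_iff by blast
qed

lemma disjoint_even_odd: "Ball E even \<Longrightarrow> Ball F odd \<Longrightarrow> E \<inter> F = {}"
  by auto

section \<open>Choice of the base by the residues of k and t\<close>

text \<open>The base {2, k} is balanced in parity. In \<open>minus\<close>, z^4 = -1 clashes with
  z^(2 * k) = -1, as k is odd; in \<open>plus\<close>, a zero satisfies z^4 = 1 and hence z^2 =
  1.\<close>

lemma circulant_nut_orders_k_odd_t_odd:
  assumes "odd k" "odd t" "t + 2 \<le> k"
  shows "4 * k \<in> circulant_nut_orders (4 * t)"
proof (rule circulant_nut_orders_even_half)
  obtain r where r: "t = 2 * r + 1" using assms(2) by (auto elim: oddE)
  have neq: "2 \<noteq> k" using assms by auto
  show "{2, k} \<subseteq> {1..<2 * k}" "{2, k} \<noteq> {}" "finite {2 :: nat}" "{2, k} \<inter> {1..<k} \<subseteq> {2}"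
    "(\<lambda>b. 2 * k - b) ` {2, k} \<inter> {1..<k} \<subseteq> {2}"
    using assms by auto
  have eo: "{c \<in> {2 :: nat}. even c} = {2}" "{c \<in> {2 :: nat}. odd c} = {}" by auto
  show "card {c \<in> {2 :: nat}. even c} + (t - 1) div 2 \<le> (k - 1) div 2"
    "card {c \<in> {2 :: nat}. odd c} + (t - 1) div 2 \<le> k div 2"
    unfolding eo(1,2) using assms by (simp_all add: r)
  show "(\<Sum>s\<in>{2, k}. (-1) ^ s) + 2 * (int ((t - 1) div 2) - int ((t - 1) div 2)) = 0"
    using neq assms(1) by simp
  show "4 * t = 2 * card {2, k} + 4 * ((t - 1) div 2 + (t - 1) div 2)"
    using neq by (simp add: r)
  fix z :: complex
  {
    assume z: "z ^ (2 * k) = -1"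
    then have z0: "z \<noteq> 0" using assms by (auto simp: zero_power)
    have "z ^ (2 * 2) \<noteq> -1"
      using minus_one_power_conflict[OF _ z, of 4 k 2] assms by auto
    then show "(\<Sum>s\<in>{2, k}. cs z s) \<noteq> 0"
      using neq cs_half_eq_0[OF z] assms cs_eq_0_iff[OF z0, of 2] by simp
  next
    fix E F :: "nat set" assume z: "z ^ (2 * k) = 1" "z\<^sup>2 \<noteq> 1" and EF: "finite E" "finite F" "Ball E even" "Ball F odd"
    show "(\<Sum>s\<in>{2, k}. cs z s) + 2 * ((\<Sum>c\<in>E. cs z c) + (\<Sum>c\<in>F. cs z c)) \<noteq> 0"
    proof
      assume *: "(\<Sum>s\<in>{2, k}. cs z s) + 2 * ((\<Sum>c\<in>E. cs z c) + (\<Sum>c\<in>F. cs z c)) = 0"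
      have "z ^ (2 * 2 ^ 1) = 1"
        by (rule single_base_zero[OF z(1) _ EF(1,2) disjoint_even_odd[OF EF(3,4)]])
          (use * neq assms in auto)
      then have "(z\<^sup>2)\<^sup>2 = 1" "(z\<^sup>2) ^ k = 1" using z(1) by (simp_all flip: power_mult)
      then show False using coprime_power_eq_1[of "z\<^sup>2" 2 k] assms(1) z(2) by simp
    qed
  }
qed

text \<open>The base {2, 6} is even, so one more odd than even pair is taken. Its sum factors
  through 1 + z^8 and 1 + z^4, nonzero in \<open>minus\<close> since k is odd. In
  \<open>plus\<close>, one Frobenius step passes to z^2 of odd order, where both factors become
  units.\<close>

lemma circulant_nut_orders_k_odd_t_even:
  assumes "odd k" "even t" "t > 0" "t + 3 \<le> k"
  shows "4 * k \<in> circulant_nut_orders (4 * t)"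
proof -
  define r where "r = t div 2 - 1"
  have r: "t = 2 * r + 2" using assms(2,3) unfolding r_def by presburger
  \<comment> \<open>For k = 5 the base element 6 exceeds k, and its partner 10 - 6 = 4 is the number
    below k that is blocked.\<close>
  define x where "x = (if k = 5 then 4 else 6 :: nat)"
  have k5: "k \<ge> 5" using assms r by simp
  have k6: "k = 5 \<or> k \<ge> 7" using k5 assms(1) by presburger
  show ?thesis
  proof (rule circulant_nut_orders_even_half)
    show "{2, 6} \<subseteq> {1..<2 * k}" "{2, 6 :: nat} \<noteq> {}" "finite {2, x}" "{2, 6} \<inter> {1..<k} \<subseteq> {2, x}"
      "(\<lambda>b. 2 * k - b) ` {2, 6} \<inter> {1..<k} \<subseteq> {2, x}"
      using k6 by (auto simp: x_def)
    have eo: "{c \<in> {2, x}. even c} = {2, x}" "{c \<in> {2, x}. odd c} = {}" "x \<noteq> 2" by (auto simp: x_def)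
    show "card {c \<in> {2, x}. even c} + r \<le> (k - 1) div 2"
      "card {c \<in> {2, x}. odd c} + (r + 1) \<le> k div 2"
      unfolding eo(1,2) using assms eo(3) by (simp_all add: r)
    show "(\<Sum>s\<in>{2, 6}. (-1) ^ s) + 2 * (int r - int (r + 1)) = 0" by simp
    show "4 * t = 2 * card {2, 6 :: nat} + 4 * (r + (r + 1))" by (simp add: r)
    fix z :: complex
    {
      assume z: "z ^ (2 * k) = -1"
      then have z0: "z \<noteq> 0" using assms by (auto simp: zero_power)
      have "z ^ 8 \<noteq> -1" "z ^ 4 \<noteq> -1"
        using minus_one_power_conflict[OF _ z, of 8 k 4] minus_one_power_conflict[OF _ z, of 4 k 2]
          assms(1) by auto
      then have nz: "(1 + z ^ (6 + 2)) * (1 + z ^ (6 - 2)) \<noteq> 0"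
        by (simp add: add_eq_0_iff)
      have "z ^ 6 * (cs z 6 + cs z 2) = (1 + z ^ (6 + 2)) * (1 + z ^ (6 - 2))"
        by (rule cs_add_cs[OF z0]) simp
      then have "cs z 6 + cs z 2 \<noteq> 0" using nz by (metis mult_zero_right)
      then show "(\<Sum>s\<in>{2, 6}. cs z s) \<noteq> 0" by (simp add: add.commute)
    next
      fix E F :: "nat set"
      assume z: "z ^ (2 * k) = 1" "z\<^sup>2 \<noteq> 1"
      have k0: "2 * k > 0" using k5 by simp
      note inv = cyc_inverse[OF z(1) k0]
      note z0 = root_of_unity_nonzero[OF z(1) k0]
      show "(\<Sum>s\<in>{2, 6}. cs z s) + 2 * ((\<Sum>c\<in>E. cs z c) + (\<Sum>c\<in>F. cs z c)) \<noteq> 0"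
      proof
        assume "(\<Sum>s\<in>{2, 6}. cs z s) + 2 * ((\<Sum>c\<in>E. cs z c) + (\<Sum>c\<in>F. cs z c)) = 0"
        from ev_of_add_eq_0[OF this cyc_add[OF sum_cs_cyc[OF z(1) k0] sum_cs_cyc[OF z(1) k0]]]
        have "0 + (\<Sum>s\<in>{2, 6}. cs z s) \<in> ev z" by simp
        from cs_frobenius[OF cyc_self inv z0 _ cyc_zero this]
        have ev: "cs (z\<^sup>2) 6 + cs (z\<^sup>2) 2 \<in> ev z" by (simp add: add.commute)
        have y: "(z\<^sup>2) ^ k = 1" using z(1) by (simp add: power_mult)
        have "coprime 8 k" "coprime 4 k"
          using assms(1) coprime_power_left_iff[of 2 3 k] coprime_power_left_iff[of 2 2 k] by simp_all
        then have "(z\<^sup>2) ^ (6 + 2) \<noteq> 1" "(z\<^sup>2) ^ (6 - 2) \<noteq> 1"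
          using coprime_power_eq_1[OF _ y, of 8] coprime_power_eq_1[OF _ y, of 4] z(2) by auto
        moreover have "inverse (z\<^sup>2) \<in> cyc z"
          using cyc_power[OF inv, of 2] by (simp add: power_inverse)
        ultimately show False
          using double_cs_not_ev[OF z(1) k0 cyc_power[OF cyc_self] _ y assms(1)] ev by simp
      qed
    }
  qed
qed

text \<open>The base is {1, k}. In \<open>minus\<close> a zero would need z^2 = -1, but k is even;
  in \<open>plus\<close>, \<open>single_base_zero\<close> with g = 0 leaves only z^2 = 1.\<close>

lemma circulant_nut_orders_k_even_t_odd:
  assumes "even k" "odd t" "t + 1 \<le> k"
  shows "4 * k \<in> circulant_nut_orders (4 * t)"
proof (rule circulant_nut_orders_even_half)
  obtain r where r: "t = 2 * r + 1" using assms(2) by (auto elim: oddE)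
  have neq: "1 \<noteq> k" and k0: "k > 0" using assms by auto
  show "{1, k} \<subseteq> {1..<2 * k}" "{1, k} \<noteq> {}" "finite {1 :: nat}" "{1, k} \<inter> {1..<k} \<subseteq> {1}"
    "(\<lambda>b. 2 * k - b) ` {1, k} \<inter> {1..<k} \<subseteq> {1}"
    using assms neq by auto
  have eo: "{c \<in> {1 :: nat}. even c} = {}" "{c \<in> {1 :: nat}. odd c} = {1}" by auto
  show "card {c \<in> {1 :: nat}. even c} + (t - 1) div 2 \<le> (k - 1) div 2"
    "card {c \<in> {1 :: nat}. odd c} + (t - 1) div 2 \<le> k div 2"
    unfolding eo(1,2) using assms by (simp_all add: r)
  show "(\<Sum>s\<in>{1, k}. (-1) ^ s) + 2 * (int ((t - 1) div 2) - int ((t - 1) div 2)) = 0"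
    using neq assms(1) by simp
  show "4 * t = 2 * card {1, k} + 4 * ((t - 1) div 2 + (t - 1) div 2)"
    using neq by (simp add: r)
  fix z :: complex
  {
    assume z: "z ^ (2 * k) = -1"
    then have z0: "z \<noteq> 0" using k0 by (auto simp: zero_power)
    have "z\<^sup>2 \<noteq> -1"
      using minus_one_power_conflict[OF z, of 2 1 k] assms by auto
    then show "(\<Sum>s\<in>{1, k}. cs z s) \<noteq> 0"
      using neq cs_half_eq_0[OF z k0] cs_eq_0_iff[OF z0, of 1] by simp
  next
    fix E F :: "nat set" assume z: "z ^ (2 * k) = 1" "z\<^sup>2 \<noteq> 1" and EF: "finite E" "finite F" "Ball E even" "Ball F odd"
    show "(\<Sum>s\<in>{1, k}. cs z s) + 2 * ((\<Sum>c\<in>E. cs z c) + (\<Sum>c\<in>F. cs z c)) \<noteq> 0"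
    proof
      assume *: "(\<Sum>s\<in>{1, k}. cs z s) + 2 * ((\<Sum>c\<in>E. cs z c) + (\<Sum>c\<in>F. cs z c)) = 0"
      have "z ^ (2 * 2 ^ 0) = 1"
        by (rule single_base_zero[OF z(1) k0 EF(1,2) disjoint_even_odd[OF EF(3,4)]])
          (use * neq in auto)
      then show False using z(2) by simp
    qed
  }
qed

text \<open>The base {3, 5} is odd, so one more even pair is taken. The exponents 8 and 2 of its
  factors differ from 2 * k in their power of two, which settles \<open>minus\<close>. In
  \<open>plus\<close>, order 4 is excluded by the odd size of E; otherwise two Frobenius steps reach
  odd order.\<close>

lemma circulant_nut_orders_k_2mod4_t_2mod4:
  assumes "k mod 4 = 2" "t mod 4 = 2" "t + 2 \<le> k" "k \<ge> 6"
  shows "4 * k \<in> circulant_nut_orders (4 * t)"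
proof (rule circulant_nut_orders_even_half)
  define r where "r = t div 4"
  have r: "t = 4 * r + 2" using assms(2) unfolding r_def by presburger
  define m where "m = k div 2"
  have m: "k = 2 * m" "odd m" using assms(1) unfolding m_def by presburger+
  show "{3, 5} \<subseteq> {1..<2 * k}" "{3, 5 :: nat} \<noteq> {}" "finite {3, 5 :: nat}"
    "{3, 5} \<inter> {1..<k} \<subseteq> {3, 5}" "(\<lambda>b. 2 * k - b) ` {3, 5} \<inter> {1..<k} \<subseteq> {3, 5}"
    using assms(4) by auto
  have eo: "{c \<in> {3, 5 :: nat}. even c} = {}" "{c \<in> {3, 5 :: nat}. odd c} = {3, 5}" by auto
  show "card {c \<in> {3, 5 :: nat}. even c} + (2 * r + 1) \<le> (k - 1) div 2"
    "card {c \<in> {3, 5 :: nat}. odd c} + 2 * r \<le> k div 2"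
    unfolding eo(1,2) using assms(3,4) by (simp_all add: r)
  show "(\<Sum>s\<in>{3, 5}. (-1) ^ s) + 2 * (int (2 * r + 1) - int (2 * r)) = 0" by simp
  show "4 * t = 2 * card {3, 5 :: nat} + 4 * (2 * r + 1 + 2 * r)" by (simp add: r)
  fix z :: complex
  {
    assume z: "z ^ (2 * k) = -1"
    then have z0: "z \<noteq> 0" using assms(4) by (auto simp: zero_power)
    have "z ^ 8 \<noteq> -1" "z\<^sup>2 \<noteq> -1"
      using minus_one_power_conflict[OF _ z, of 8 m 2] minus_one_power_conflict[OF z, of 2 1 k] m
      by auto
    then have nz: "(1 + z ^ (5 + 3)) * (1 + z ^ (5 - 3)) \<noteq> 0"
      by (simp add: add_eq_0_iff)
    have "z ^ 5 * (cs z 5 + cs z 3) = (1 + z ^ (5 + 3)) * (1 + z ^ (5 - 3))"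
      by (rule cs_add_cs[OF z0]) simp
    then have "cs z 5 + cs z 3 \<noteq> 0" using nz by (metis mult_zero_right)
    then show "(\<Sum>s\<in>{3, 5}. cs z s) \<noteq> 0" by (simp add: add.commute)
  next
    fix E F :: "nat set" assume z: "z ^ (2 * k) = 1" "z\<^sup>2 \<noteq> 1"
      and EF: "finite E" "Ball E even" "Ball F odd" "card E = 2 * r + 1"
    have k0: "2 * k > 0" using assms(4) by simp
    note inv = cyc_inverse[OF z(1) k0]
    note z0 = root_of_unity_nonzero[OF z(1) k0]
    show "(\<Sum>s\<in>{3, 5}. cs z s) + 2 * ((\<Sum>c\<in>E. cs z c) + (\<Sum>c\<in>F. cs z c)) \<noteq> 0"
    proof (cases "z ^ 4 = 1")
      case True
      note z2 = square_minus_one_of_power4[OF True z(2)]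
      have "(\<Sum>s\<in>{3, 5}. cs z s) = 4 * of_int 0"
        using cs_square_minus_one_odd[OF z2] by simp
      then show ?thesis
        by (rule sum_cs_order_4_nonzero[OF z2 EF(1,2,3)]) (simp add: EF(4))
    next
      case False
      show ?thesis
      proof
        assume "(\<Sum>s\<in>{3, 5}. cs z s) + 2 * ((\<Sum>c\<in>E. cs z c) + (\<Sum>c\<in>F. cs z c)) = 0"
        from ev_of_add_eq_0[OF this cyc_add[OF sum_cs_cyc[OF z(1) k0] sum_cs_cyc[OF z(1) k0]]]
        have "0 + (\<Sum>s\<in>{3, 5}. cs z s) \<in> ev z" by simp
        from cs_frobenius_power[OF cyc_self inv z0 _ cyc_zero this, of 2]
        have ev: "cs (z ^ 4) 5 + cs (z ^ 4) 3 \<in> ev z" by (simp add: add.commute)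
        have y: "(z ^ 4) ^ m = 1" using z(1) by (simp add: m flip: power_mult)
        have "coprime 8 m" "coprime 2 m"
          using m(2) coprime_power_left_iff[of 2 3 m] by simp_all
        then have "(z ^ 4) ^ (5 + 3) \<noteq> 1" "(z ^ 4) ^ (5 - 3) \<noteq> 1"
          using coprime_power_eq_1[OF _ y, of 8] coprime_power_eq_1[OF _ y, of 2] False by auto
        moreover have "inverse (z ^ 4) \<in> cyc z"
          using cyc_power[OF inv, of 4] by (simp add: power_inverse)
        ultimately show False
          using double_cs_not_ev[OF z(1) k0 cyc_power[OF cyc_self] _ y m(2)] ev by simp
      qed
    qed
  }
qed

text \<open>The base {2^g, k} is even, so one more odd pair is taken. After
  \<open>single_base_zero\<close> both base terms are 2 or -2 and only roots of order dividing
  2^(g+1) remain. In the applications 2^g is never the exact power of two in k, which gives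
  \<open>minus\<close>.\<close>

lemma circulant_nut_orders_k_even_t_even:
  assumes k: "even k" "2 ^ g < k" and g: "g > 0" and t: "even t" "t > 0" "t + 2 \<le> k"
    and minus: "\<And>z :: complex. z ^ (2 * k) = -1 \<Longrightarrow> z ^ (2 * 2 ^ g) \<noteq> -1"
    and plus: "\<And>(z :: complex) (E :: nat set) (F :: nat set). z ^ (2 * k) = 1 \<Longrightarrow> z\<^sup>2 \<noteq> 1 \<Longrightarrow> z ^ (2 * 2 ^ g) = 1 \<Longrightarrow>
      finite E \<Longrightarrow> finite F \<Longrightarrow> Ball E even \<Longrightarrow> Ball F odd \<Longrightarrow> card E = t div 2 - 1 \<Longrightarrow> card F = t div 2 \<Longrightarrow>
      2 * (z ^ 2 ^ g + z ^ k) + 2 * ((\<Sum>c\<in>E. cs z c) + (\<Sum>c\<in>F. cs z c)) \<noteq> 0"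
  shows "4 * k \<in> circulant_nut_orders (4 * t)"
proof (rule circulant_nut_orders_even_half)
  define r where "r = t div 2 - 1"
  have r: "t = 2 * Suc r" using t(1,2) unfolding r_def by presburger
  have neq: "2 ^ g \<noteq> k" and k0: "k > 0" using k by auto
  have ev: "even (2 ^ g :: nat)" using g by simp
  have sumB: "sum f {2 ^ g, k} = f (2 ^ g) + f k" for f :: "nat \<Rightarrow> 'b :: comm_monoid_add"
    using neq by simp
  show "{2 ^ g, k} \<subseteq> {1..<2 * k}" "{2 ^ g, k} \<noteq> {}" "finite {2 ^ g :: nat}"
    "{2 ^ g, k} \<inter> {1..<k} \<subseteq> {2 ^ g}" "(\<lambda>b. 2 * k - b) ` {2 ^ g, k} \<inter> {1..<k} \<subseteq> {2 ^ g}"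
    using k by auto
  have eo: "{c \<in> {2 ^ g :: nat}. even c} = {2 ^ g}" "{c \<in> {2 ^ g :: nat}. odd c} = {}" using ev by auto
  show "card {c \<in> {2 ^ g :: nat}. even c} + (t div 2 - 1) \<le> (k - 1) div 2"
    "card {c \<in> {2 ^ g :: nat}. odd c} + t div 2 \<le> k div 2"
    unfolding eo(1,2) using t(3) by (simp_all add: r)
  show "(\<Sum>s\<in>{2 ^ g, k}. (-1) ^ s) + 2 * (int (t div 2 - 1) - int (t div 2)) = 0"
    unfolding sumB using ev k(1) by (simp add: r)
  show "4 * t = 2 * card {2 ^ g, k} + 4 * (t div 2 - 1 + t div 2)"
    using neq by (simp add: r)
  fix z :: complex
  {
    assume z: "z ^ (2 * k) = -1"
    then have z0: "z \<noteq> 0" using k0 by (auto simp: zero_power)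
    show "(\<Sum>s\<in>{2 ^ g, k}. cs z s) \<noteq> 0"
      unfolding sumB using cs_half_eq_0[OF z k0] cs_eq_0_iff[OF z0, of "2 ^ g"] minus[OF z] by simp
  next
    fix E F :: "nat set" assume z: "z ^ (2 * k) = 1" "z\<^sup>2 \<noteq> 1" and EF: "finite E" "finite F" "Ball E even" "Ball F odd"
      and card: "card E = t div 2 - 1" "card F = t div 2"
    show "(\<Sum>s\<in>{2 ^ g, k}. cs z s) + 2 * ((\<Sum>c\<in>E. cs z c) + (\<Sum>c\<in>F. cs z c)) \<noteq> 0"
    proof
      assume *: "(\<Sum>s\<in>{2 ^ g, k}. cs z s) + 2 * ((\<Sum>c\<in>E. cs z c) + (\<Sum>c\<in>F. cs z c)) = 0"
      have zg: "z ^ (2 * 2 ^ g) = 1"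
        by (rule single_base_zero[OF z(1) k0 EF(1,2) disjoint_even_odd[OF EF(3,4)]])
          (use * in \<open>simp add: sumB\<close>)
      show False
        using plus[OF z zg EF card] * cs_of_sq_one[OF zg] cs_of_sq_one[OF z(1)]
        unfolding sumB by (simp add: distrib_left)
    qed
  }
qed

text \<open>With g = 2 the remaining roots have order 4. There z^4 = 1 and z^k = -1, so the base
  cancels, while E has odd size.\<close>

lemma circulant_nut_orders_k_2mod4_t_0mod4:
  assumes "k mod 4 = 2" "t mod 4 = 0" "t > 0" "t + 2 \<le> k"
  shows "4 * k \<in> circulant_nut_orders (4 * t)"
proof (rule circulant_nut_orders_k_even_t_even[where g = 2])
  define m where "m = k div 2"
  have m: "k = 2 * m" "odd m" using assms(1) unfolding m_def by presburger+
  show "even k" "2\<^sup>2 < k" "even t" using assms by (simp, simp, presburger)+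
  fix z :: complex
  {
    assume z: "z ^ (2 * k) = -1"
    show "z ^ (2 * 2\<^sup>2) \<noteq> -1"
      using minus_one_power_conflict[OF _ z, of 8 m 2] m by auto
  next
    fix E F :: "nat set" assume z: "z ^ (2 * k) = 1" "z\<^sup>2 \<noteq> 1" "z ^ (2 * 2\<^sup>2) = 1"
      and EF: "finite E" "Ball E even" "Ball F odd" "card E = t div 2 - 1"
    have "(z ^ 4)\<^sup>2 = 1" "(z ^ 4) ^ m = 1" using z by (simp_all add: m flip: power_mult)
    then have z4: "z ^ 4 = 1" using coprime_power_eq_1[of "z ^ 4" 2 m] m(2) by simp
    note z2 = square_minus_one_of_power4[OF z4 z(2)]
    have "z ^ k = -1" using power_mult_eqI[OF z2 m(1)] m(2) by simp
    then have "2 * (z ^ 2\<^sup>2 + z ^ k) = 4 * of_int 0" using z4 by simp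
    moreover have "odd (0 + int (card E))" unfolding EF(4) using assms(2,3) by simp presburger
    ultimately show "2 * (z ^ 2\<^sup>2 + z ^ k) + 2 * ((\<Sum>c\<in>E. cs z c) + (\<Sum>c\<in>F. cs z c)) \<noteq> 0"
      by (rule sum_cs_order_4_nonzero[OF z2 EF(1,2,3)])
  }
qed (use assms in auto)

text \<open>With g = 1 the remaining roots have order 4. There z^2 = -1 and z^k = 1, so the base
  cancels, while E has odd size.\<close>

lemma circulant_nut_orders_k_0mod4_t_0mod4:
  assumes "k mod 4 = 0" "t mod 4 = 0" "t > 0" "t + 2 \<le> k"
  shows "4 * k \<in> circulant_nut_orders (4 * t)"
proof (rule circulant_nut_orders_k_even_t_even[where g = 1])
  define m where "m = k div 4"
  have m: "k = 4 * m" using assms(1) unfolding m_def by presburger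
  show "even k" "2 ^ 1 < k" "even t" using assms m by (simp, simp, presburger)+
  fix z :: complex
  {
    assume z: "z ^ (2 * k) = -1"
    show "z ^ (2 * 2 ^ 1) \<noteq> -1"
      using minus_one_power_conflict[OF z, of 4 1 "2 * m"] m by auto
  next
    fix E F :: "nat set" assume z: "z ^ (2 * k) = 1" "z\<^sup>2 \<noteq> 1" "z ^ (2 * 2 ^ 1) = 1"
      and EF: "finite E" "Ball E even" "Ball F odd" "card E = t div 2 - 1"
    have z4: "z ^ 4 = 1" using z(3) by simp
    note z2 = square_minus_one_of_power4[OF z4 z(2)]
    have "z ^ k = 1" using power_mult_eqI[OF z4 m] by simp
    then have "2 * (z ^ 2 ^ 1 + z ^ k) = 4 * of_int 0" using z2 by simp
    moreover have "odd (0 + int (card E))" unfolding EF(4) using assms(2,3) by simp presburger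
    ultimately show "2 * (z ^ 2 ^ 1 + z ^ k) + 2 * ((\<Sum>c\<in>E. cs z c) + (\<Sum>c\<in>F. cs z c)) \<noteq> 0"
      by (rule sum_cs_order_4_nonzero[OF z2 EF(1,2,3)])
  }
qed (use assms in auto)

text \<open>With g = 2 the orders 4 and 8 remain. At order 4 the base contributes 4 and E has even
  size; at order 8 the base cancels and F has odd size.\<close>

lemma circulant_nut_orders_k_0mod8_t_2mod4:
  assumes "k mod 8 = 0" "t mod 4 = 2" "t + 2 \<le> k"
  shows "4 * k \<in> circulant_nut_orders (4 * t)"
proof (rule circulant_nut_orders_k_even_t_even[where g = 2])
  define m where "m = k div 8"
  have m: "k = 8 * m" using assms(1) unfolding m_def by presburger
  have "k \<ge> 8" using assms by presburger
  then show "even k" "2\<^sup>2 < k" using m by simp_all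
  show "even t" "t > 0" using assms(2) by presburger+
  fix z :: complex
  {
    assume z: "z ^ (2 * k) = -1"
    show "z ^ (2 * 2\<^sup>2) \<noteq> -1"
      using minus_one_power_conflict[OF z, of 8 1 "2 * m"] m by auto
  next
    fix E F :: "nat set" assume z: "z ^ (2 * k) = 1" "z\<^sup>2 \<noteq> 1" "z ^ (2 * 2\<^sup>2) = 1"
      and EF: "finite E" "finite F" "Ball E even" "Ball F odd" "card E = t div 2 - 1" "card F = t div 2"
    have z8: "z ^ 8 = 1" using z(3) by simp
    have zk: "z ^ k = 1" using power_mult_eqI[OF z8 m] by simp
    have "(z ^ 4)\<^sup>2 = 1" using z8 by (simp flip: power_mult)
    then consider "z ^ 4 = 1" | "z ^ 4 = -1" unfolding power2_eq_1_iff by blast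
    then show "2 * (z ^ 2\<^sup>2 + z ^ k) + 2 * ((\<Sum>c\<in>E. cs z c) + (\<Sum>c\<in>F. cs z c)) \<noteq> 0"
    proof cases
      case 1
      note z2 = square_minus_one_of_power4[OF 1 z(2)]
      have "2 * (z ^ 2\<^sup>2 + z ^ k) = 4 * of_int 1" using 1 zk by simp
      moreover have "odd (1 + int (card E))" unfolding EF(5) using assms(2) by simp presburger
      ultimately show ?thesis by (rule sum_cs_order_4_nonzero[OF z2 EF(1,3,4)])
    next
      case 2
      have "odd (card F)" unfolding EF(6) using assms(2) by presburger
      from sum_cs_order_8_nonzero[OF 2 EF(1,3,2,4) this]
      have "2 * ((\<Sum>c\<in>E. cs z c) + (\<Sum>c\<in>F. cs z c)) \<noteq> 0"
        by (metis mult_eq_0_iff zero_neq_numeral)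
      moreover have "2 * (z ^ 2\<^sup>2 + z ^ k) = 0" using 2 zk by simp
      ultimately show ?thesis by (simp only: add_0 simp_thms)
    qed
  }
qed (use assms in auto)

text \<open>With g = 3 the common solutions of z^16 = 1 and z^(2 * k) = 1 satisfy z^8 = 1. At order
  4 the base contributes 4 and E has even size; at order 8 it cancels and F has odd size. The bound
  on k keeps 2^3 below k.\<close>

lemma circulant_nut_orders_k_4mod8_t_2mod4:
  assumes "k mod 8 = 4" "t mod 4 = 2" "t + 2 \<le> k" "k \<ge> 12"
  shows "4 * k \<in> circulant_nut_orders (4 * t)"
proof (rule circulant_nut_orders_k_even_t_even[where g = 3])
  define m where "m = k div 4"
  have m: "k = 4 * m" "odd m" using assms(1) unfolding m_def by presburger+
  show "even k" "2 ^ 3 < k" using assms m by simp_all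
  show "even t" "t > 0" using assms(2) by presburger+
  fix z :: complex
  {
    assume z: "z ^ (2 * k) = -1"
    show "z ^ (2 * 2 ^ 3) \<noteq> -1"
      using minus_one_power_conflict[OF _ z, of 16 m 2] m by auto
  next
    fix E F :: "nat set" assume z: "z ^ (2 * k) = 1" "z\<^sup>2 \<noteq> 1" "z ^ (2 * 2 ^ 3) = 1"
      and EF: "finite E" "finite F" "Ball E even" "Ball F odd" "card E = t div 2 - 1" "card F = t div 2"
    have "(z ^ 8)\<^sup>2 = 1" "(z ^ 8) ^ m = 1" using z by (simp_all add: m flip: power_mult)
    then have z8: "z ^ 8 = 1" using coprime_power_eq_1[of "z ^ 8" 2 m] m(2) by simp
    have "(z ^ 4)\<^sup>2 = 1" using z8 by (simp flip: power_mult)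
    then consider "z ^ 4 = 1" | "z ^ 4 = -1" unfolding power2_eq_1_iff by blast
    then show "2 * (z ^ 2 ^ 3 + z ^ k) + 2 * ((\<Sum>c\<in>E. cs z c) + (\<Sum>c\<in>F. cs z c)) \<noteq> 0"
    proof cases
      case 1
      note z2 = square_minus_one_of_power4[OF 1 z(2)]
      have "z ^ k = 1" using power_mult_eqI[OF 1 m(1)] by simp
      then have "2 * (z ^ 2 ^ 3 + z ^ k) = 4 * of_int 1" using z8 by simp
      moreover have "odd (1 + int (card E))" unfolding EF(5) using assms(2) by simp presburger
      ultimately show ?thesis by (rule sum_cs_order_4_nonzero[OF z2 EF(1,3,4)])
    next
      case 2
      have "z ^ k = -1" using power_mult_eqI[OF 2 m(1)] m(2) by simp
      moreover have "odd (card F)" unfolding EF(6) using assms(2) by presburger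
      ultimately have "2 * ((\<Sum>c\<in>E. cs z c) + (\<Sum>c\<in>F. cs z c)) \<noteq> 0"
        using sum_cs_order_8_nonzero[OF 2 EF(1,3,2,4)] by (metis mult_eq_0_iff zero_neq_numeral)
      moreover have "2 * (z ^ 2 ^ 3 + z ^ k) = 0" using z8 \<open>z ^ k = -1\<close> by simp
      ultimately show ?thesis by (simp only: add_0 simp_thms)
    qed
  }
qed (use assms in auto)

section \<open>Assembly of the classification\<close>

lemma circulant_nut_orders_exist:
  assumes n: "even n" "4 * t + 4 \<le> n" and t: "t > 0"
    and even_t: "even t \<Longrightarrow> 4 * t + 6 \<le> n" and "\<not> (t = 2 \<and> n = 16)"
  shows "n \<in> circulant_nut_orders (4 * t)"
proof (cases "4 dvd n")
  case False
  define m where "m = n div 4"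
  have "n = 2 * (2 * m + 1)" using n(1) False unfolding m_def by presburger
  moreover have "t - 1 + 2 \<le> m" using n even_t t False unfolding m_def by presburger
  ultimately show ?thesis
    using circulant_nut_orders_odd_half[of "2 * m + 1" m "t - 1"] t by (simp add: algebra_simps)
next
  case True
  then obtain k where k: "n = 4 * k" by blast
  have 1: "t + 1 \<le> k" using n(2) k by simp
  have 2: "t + 2 \<le> k" if "even t" using even_t[OF that] k by simp
  \<comment> \<open>Residues modulo 4 and 8 matter only when k and t are both even, where the base
    depends on the power of two in k.\<close>
  consider "odd k" "odd t" | "odd k" "even t" | "even k" "odd t"
    | "k mod 4 = 2" "t mod 4 = 2" | "k mod 4 = 2" "t mod 4 = 0"
    | "k mod 4 = 0" "t mod 4 = 0" | "k mod 8 = 0" "t mod 4 = 2" | "k mod 8 = 4" "t mod 4 = 2"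
    by atomize_elim presburger
  then show ?thesis unfolding k
  proof cases
    case 1
    then have "t + 2 \<le> k" using \<open>t + 1 \<le> k\<close> by presburger
    then show "4 * k \<in> circulant_nut_orders (4 * t)" by (rule circulant_nut_orders_k_odd_t_odd[OF 1])
  next
    case c: 2
    then have "t + 3 \<le> k" using 2 by presburger
    then show "4 * k \<in> circulant_nut_orders (4 * t)" by (rule circulant_nut_orders_k_odd_t_even[OF c t])
  next
    case c: 3
    show "4 * k \<in> circulant_nut_orders (4 * t)" by (rule circulant_nut_orders_k_even_t_odd[OF c 1])
  next
    case c: 4
    have "even t" using c by presburger
    moreover have "k \<ge> 6" using c 2 \<open>even t\<close> by presburger
    ultimately show "4 * k \<in> circulant_nut_orders (4 * t)" using circulant_nut_orders_k_2mod4_t_2mod4[OF c] 2 by blast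
  next
    case c: 5
    have "even t" using c by presburger
    then show "4 * k \<in> circulant_nut_orders (4 * t)" using circulant_nut_orders_k_2mod4_t_0mod4[OF c t] 2 by blast
  next
    case c: 6
    have "even t" using c by presburger
    then show "4 * k \<in> circulant_nut_orders (4 * t)" using circulant_nut_orders_k_0mod4_t_0mod4[OF c t] 2 by blast
  next
    case c: 7
    have "even t" using c by presburger
    then show "4 * k \<in> circulant_nut_orders (4 * t)" using circulant_nut_orders_k_0mod8_t_2mod4[OF c] 2 by blast
  next
    case c: 8
    have "even t" using c by presburger
    then have le: "t + 2 \<le> k" using 2 by blast
    \<comment> \<open>Here k = 4 would force t = 2 and n = 16, the excluded exceptional
      order.\<close>
    have "k \<noteq> 4" using le c assms(5) k by presburger
    then have "k \<ge> 12" using c by presburger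
    then show "4 * k \<in> circulant_nut_orders (4 * t)" using circulant_nut_orders_k_4mod8_t_2mod4[OF c le] by blast
  qed
qed

theorem theorem1p5:
  fixes d :: nat
  shows "(d = 0 \<or> \<not> 4 dvd d \<longrightarrow> circulant_nut_orders d = {}) \<and>
    (d mod 8 = 4 \<longrightarrow> circulant_nut_orders d = {n. 2 dvd n \<and> n \<ge> d + 4}) \<and>
    (d = 8 \<longrightarrow> circulant_nut_orders d = {14} \<union> {n. 2 dvd n \<and> n \<ge> 18}) \<and>
    (8 dvd d \<and> d \<ge> 16 \<longrightarrow> circulant_nut_orders d = {n. 2 dvd n \<and> n \<ge> d + 6})"
proof (intro conjI impI)
  assume "d = 0 \<or> \<not> 4 dvd d"
  then show "circulant_nut_orders d = {}"
    using circulant_nut_orders_bound(1,2)[of _ d] by auto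
next
  assume d: "d mod 8 = 4"
  define t where "t = d div 4"
  have t: "d = 4 * t" "odd t" using d unfolding t_def by presburger+
  show "circulant_nut_orders d = {n. 2 dvd n \<and> n \<ge> d + 4}"
  proof (intro equalityI subsetI CollectI)
    fix n assume "n \<in> {n. 2 dvd n \<and> n \<ge> d + 4}"
    then show "n \<in> circulant_nut_orders d"
      using circulant_nut_orders_exist[of n t] t odd_pos[OF t(2)] by force
  qed (use circulant_nut_orders_bound in auto)
next
  assume d: "d = 8"
  show "circulant_nut_orders d = {14} \<union> {n. 2 dvd n \<and> n \<ge> 18}"
  proof (intro equalityI subsetI)
    fix n assume n: "n \<in> circulant_nut_orders d"
    then have "even n" "n \<ge> 14" "n \<noteq> 16"
      using circulant_nut_orders_bound[OF n] sixteen_notin_circulant_nut_orders_8 d by auto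
    then have "n = 14 \<or> n \<ge> 18" by presburger
    with \<open>even n\<close> show "n \<in> {14} \<union> {n. 2 dvd n \<and> n \<ge> 18}" by auto
  next
    fix n :: nat assume "n \<in> {14} \<union> {n. 2 dvd n \<and> n \<ge> 18}"
    then show "n \<in> circulant_nut_orders d"
      using circulant_nut_orders_exist[of n 2] d by auto
  qed
next
  assume d: "8 dvd d \<and> d \<ge> 16"
  define t where "t = d div 4"
  have t: "d = 4 * t" "even t" "t \<ge> 4" using d unfolding t_def by presburger+
  show "circulant_nut_orders d = {n. 2 dvd n \<and> n \<ge> d + 6}"
  proof (intro equalityI subsetI CollectI)
    fix n assume "n \<in> {n. 2 dvd n \<and> n \<ge> d + 6}"
    then show "n \<in> circulant_nut_orders d"
      using circulant_nut_orders_exist[of n t] t by auto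
  qed (use circulant_nut_orders_bound d in auto)
qed

end
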